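(* Let $(G,\varphi)$ be a complex unit gain graph whose underlying graph $G$ has order $n$. Then $r(G,\varphi)=2n-2c(G)-2\alpha(G)$ if and only if all of the following hold: (i) the cycles (if any) of $G$ are pairwise vertex-disjoint; (ii) for each cycle $C_l$ (of length $l$) of $G$, either $l$ is even and $\varphi(C_l)=(-1)^{l/2}$, or $l$ is odd and $\mathrm{Re}\big((-1)^{(l-1)/2}\varphi(C_l)\big)=0$; (iii) $\alpha(T_G)=\alpha([T_G])+c(G)$ (where $T_G$ and $[T_G]$ are well defined because of (i)).
   Context: All graphs are simple and finite. A complex unit gain graph $(G,\varphi)$ consists of a simple graph $G$ with vertex set $\{v_1,\dots,v_n\}$ and a gain function $\varphi$ assigning to each oriented edge $e_{ij}$ (for each edge $v_iv_j$) a complex number of modulus $1$ with $\varphi(e_{ji})=\overline{\varphi(e_{ij})}$. Its adjacency matrix $A(G,\varphi)$ has $(i,j)$-entry $\varphi(e_{ij})$ if $v_i,v_j$ are adjacent and $0$ otherwise; $r(G,\varphi)$ is its rank. $\alpha(H)$ denotes the independence number of a graph $H$; $c(G)=|E(G)|-|V(G)|+\omega(G)$ is the cyclomatic number, $\omega(G)$ the number of connected components. For a cycle $C_l=u_1u_2\cdots u_lu_1$ of $G$, its gain is $\varphi(C_l)=\varphi(e_{u_1u_2})\varphi(e_{u_2u_3})\cdots\varphi(e_{u_{l-1}u_l})\varphi(e_{u_lu_1})$ (the conditions in (ii) do not depend on the starting vertex or direction of traversal). For a graph $G$ whose cycles are pairwise vertex-disjoint, $T_G$ is the acyclic graph obtained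 from $G$ by contracting each cycle into a single vertex (called a cyclic vertex); $\mathscr{O}_G$ is the set of cyclic vertices, and $[T_G]=T_G-\mathscr{O}_G$ is the subgraph of $T_G$ induced by the non-cyclic vertices. *)

theory Defs
  imports "HOL-Analysis.Analysis"
begin

text \<open>A simple graph on the finite vertex type 'n (vertex set = UNIV) is given by a
  symmetric irreflexive adjacency relation.\<close>

definition simple_graph :: "('n \<Rightarrow> 'n \<Rightarrow> bool) \<Rightarrow> bool" where
  "simple_graph adj \<longleftrightarrow> (\<forall>u v. adj u v \<longrightarrow> adj v u) \<and> (\<forall>u. \<not> adj u u)"

definition unit_gain :: "('n \<Rightarrow> 'n \<Rightarrow> bool) \<Rightarrow> ('n \<Rightarrow> 'n \<Rightarrow> complex) \<Rightarrow> bool" where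
  "unit_gain adj \<phi> \<longleftrightarrow> (\<forall>u v. adj u v \<longrightarrow> norm (\<phi> u v) = 1 \<and> \<phi> v u = cnj (\<phi> u v))"

definition gain_adj_matrix ::
  "('n::finite \<Rightarrow> 'n \<Rightarrow> bool) \<Rightarrow> ('n \<Rightarrow> 'n \<Rightarrow> complex) \<Rightarrow> complex^'n^'n" where
  "gain_adj_matrix adj \<phi> = (\<chi> i j. if adj i j then \<phi> i j else 0)"

definition edges :: "('n \<Rightarrow> 'n \<Rightarrow> bool) \<Rightarrow> 'n set set" where
  "edges adj = {{u, v} | u v. adj u v}"

definition num_components :: "('n \<Rightarrow> 'n \<Rightarrow> bool) \<Rightarrow> nat" where
  "num_components adj = card (UNIV // {(u, v). adj\<^sup>*\<^sup>* u v})"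

definition cyclomatic :: "('n::finite \<Rightarrow> 'n \<Rightarrow> bool) \<Rightarrow> int" where
  "cyclomatic adj = int (card (edges adj)) - int CARD('n) + int (num_components adj)"

definition indep_num :: "'v set \<Rightarrow> ('v \<Rightarrow> 'v \<Rightarrow> bool) \<Rightarrow> nat" where
  "indep_num V adj = Max {card S | S. S \<subseteq> V \<and> (\<forall>x\<in>S. \<forall>y\<in>S. \<not> adj x y)}"

definition is_cycle :: "('n \<Rightarrow> 'n \<Rightarrow> bool) \<Rightarrow> 'n list \<Rightarrow> bool" where
  "is_cycle adj cs \<longleftrightarrow> length cs \<ge> 3 \<and> distinct cs \<and>
     (\<forall>i < length cs. adj (cs ! i) (cs ! ((i + 1) mod length cs)))"

definition cycle_edges :: "'n list \<Rightarrow> 'n set set" where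
  "cycle_edges cs = {{cs ! i, cs ! ((i + 1) mod length cs)} | i. i < length cs}"

definition cycle_gain :: "('n \<Rightarrow> 'n \<Rightarrow> complex) \<Rightarrow> 'n list \<Rightarrow> complex" where
  "cycle_gain \<phi> cs = (\<Prod>i < length cs. \<phi> (cs ! i) (cs ! ((i + 1) mod length cs)))"

text \<open>Distinct cycles (as subgraphs, i.e. distinct edge sets) share no vertex.\<close>
definition cycles_disjoint :: "('n \<Rightarrow> 'n \<Rightarrow> bool) \<Rightarrow> bool" where
  "cycles_disjoint adj \<longleftrightarrow> (\<forall>c1 c2. is_cycle adj c1 \<and> is_cycle adj c2 \<and>
      cycle_edges c1 \<noteq> cycle_edges c2 \<longrightarrow> set c1 \<inter> set c2 = {})"

definition gain_condition :: "('n \<Rightarrow> 'n \<Rightarrow> bool) \<Rightarrow> ('n \<Rightarrow> 'n \<Rightarrow> complex) \<Rightarrow> bool" where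
  "gain_condition adj \<phi> \<longleftrightarrow> (\<forall>cs. is_cycle adj cs \<longrightarrow>
      (let l = length cs in
        (even l \<and> cycle_gain \<phi> cs = (-1) ^ (l div 2)) \<or>
        (odd l \<and> Re ((-1) ^ ((l - 1) div 2) * cycle_gain \<phi> cs) = 0)))"

text \<open>Contraction map to T_G: a vertex on a cycle is sent to the cyclic vertex
  Inr (vertex set of its cycle); any other vertex v is sent to Inl v.
  (Well defined when cycles are pairwise vertex-disjoint.)\<close>
definition contr :: "('n \<Rightarrow> 'n \<Rightarrow> bool) \<Rightarrow> 'n \<Rightarrow> 'n + 'n set" where
  "contr adj v = (if \<exists>c. is_cycle adj c \<and> v \<in> set c
     then Inr (set (SOME c. is_cycle adj c \<and> v \<in> set c)) else Inl v)"

definition TG_vertices :: "('n \<Rightarrow> 'n \<Rightarrow> bool) \<Rightarrow> ('n + 'n set) set" where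
  "TG_vertices adj = range (contr adj)"

definition TG_adj :: "('n \<Rightarrow> 'n \<Rightarrow> bool) \<Rightarrow> ('n + 'n set) \<Rightarrow> ('n + 'n set) \<Rightarrow> bool" where
  "TG_adj adj x y \<longleftrightarrow> x \<noteq> y \<and> (\<exists>u v. adj u v \<and> contr adj u = x \<and> contr adj v = y)"

definition TG_noncyclic_vertices :: "('n \<Rightarrow> 'n \<Rightarrow> bool) \<Rightarrow> ('n + 'n set) set" where
  "TG_noncyclic_vertices adj = {x \<in> TG_vertices adj. isl x}"

end

theory Submission
  imports Defs
begin

text \<open>
  Write \<open>\<tau> = n - \<alpha>\<close> for the vertex cover number, so that the claim concerns equality in \<open>r \<ge> 2\<tau> - 2c\<close>.
  Deleting a vertex of a cycle lowers \<open>c\<close>, lowers \<open>\<tau>\<close> by at most one and does not raise \<open>r\<close>; deleting the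
  neighbour of a pendant vertex lowers \<open>\<tau>\<close> by one and \<open>r\<close> by two. This gives the bound by induction, and
  equality is inherited by both kinds of deletion, with all the inequalities sharp. In particular deleting a vertex
  from a cycle lowers \<open>c\<close> by exactly one, which makes cycles disjoint, and it preserves \<open>r\<close>, which
  yields null vectors that do not vanish on the cycles; reducing to a single cycle gives the gain condition.
  For a pendant cycle such a kernel vector shows that deleting the outer neighbour of the cycle lowers the rank by
  two, so pendant cycles behave like pendant vertices. Removing them one after another yields a
  minimum cover \<open>K\<close> of the forest of non-cyclic vertices that covers all edges off the cycles, which is (iii).
  Conversely, deleting such a \<open>K\<close> leaves disjoint singular cycles, whence \<open>r \<le> 2\<tau> - 2c\<close>.
\<close>

subsection \<open>Rank of matrices over a field\<close>

text \<open>Both drops of the rank by two have one source: a vector \<open>w\<close> with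
  \<open>w $ y = 0\<close> that the matrix maps to a nonzero multiple of the unit vector at
  \<open>y\<close>. It accounts for the row of \<open>y\<close>; as the matrix is Hermitian, the
  conjugate of \<open>w\<close> accounts for the column. For a pendant vertex \<open>w\<close> is a
  unit vector, for a pendant cycle a kernel vector of the cycle extended by zero. The latter exists
  only if the cycle is singular, which is what (ii) expresses, so (ii) has to be derived from
  equality before (iii). A singular cycle of length l has rank at most 2 * ceil(l/2) - 2, two below
  twice its cover number. These deficits, one for each cycle, add up to the term 2c. As for (iii),
  \<alpha>(T_G) never exceeds \<alpha>([T_G]) + c. Equality says that some maximum independent set
  of T_G contains all cyclic vertices; the non-cyclic vertices that it misses form the cover
  \<open>K\<close>.\<close>

lemma matrix_vector_mult_axis:
  fixes A :: "'a::field^'n^'m"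
  shows "A *v axis i 1 = column i A"
  by (auto simp: vec_eq_iff matrix_vector_mult_def column_def axis_def if_distrib cong: if_cong)

lemma dim_range_eq_dim_columns:
  fixes A :: "'a::field^'n^'m"
  shows "vec.dim (range ((*v) A)) = vec.dim (columns A)"
proof -
  have "range ((*v) A) \<subseteq> vec.span (columns A)"
  proof clarify
    fix v
    have "column i A \<in> columns A" for i by (auto simp: columns_def)
    then show "A *v v \<in> vec.span (columns A)"
      unfolding matrix_mult_sum by (intro vec.span_sum vec.span_scale vec.span_base)
  qed
  moreover have "columns A \<subseteq> range ((*v) A)"
  proof
    fix v assume "v \<in> columns A"
    then obtain i where v: "v = column i A" by (auto simp: columns_def)
    have "v = A *v axis i 1" by (simp add: v matrix_vector_mult_axis)
    then show "v \<in> range ((*v) A)" by blast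
  qed
  ultimately show ?thesis
    by (metis antisym vec.dim_mono vec.dim_subset)
qed

text \<open>Expanding the rows in a basis \<open>B\<close> of the row space factors the matrix, so
  every column is a combination of the card \<open>B\<close> coefficient vectors.\<close>

lemma dim_columns_le_rank:
  fixes A :: "'a::field^'n^'m"
  shows "vec.dim (columns A) \<le> rank A"
proof -
  obtain B where B: "B \<subseteq> rows A" "vec.independent B" "rows A \<subseteq> vec.span B" "card B = vec.dim (rows A)"
    using vec.basis_exists by blast
  have fB: "finite B" using B(2) vec.finiteI_independent by blast
  have "\<exists>c. row i A = (\<Sum>b\<in>B. c b *s b)" for i
  proof -
    have "row i A \<in> vec.span B" using B(3) by (auto simp: rows_def)
    then show ?thesis using vec.span_finite[OF fB] by auto
  qed
  then obtain c where c: "\<And>i. row i A = (\<Sum>b\<in>B. c i b *s b)" by metis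
  let ?d = "\<lambda>b. (\<chi> i. c i b)"
  have "columns A \<subseteq> vec.span (?d ` B)"
  proof
    fix v assume "v \<in> columns A"
    then obtain j where v: "v = column j A" by (auto simp: columns_def)
    have "A $ i $ j = (\<Sum>b\<in>B. c i b * b $ j)" for i
      using arg_cong[OF c[of i], of "\<lambda>v. v $ j"] by (simp add: row_def)
    then have "v = (\<Sum>b\<in>B. (b $ j) *s ?d b)"
      by (simp add: v column_def vec_eq_iff mult.commute)
    then show "v \<in> vec.span (?d ` B)"
      by (simp only:) (intro vec.span_sum vec.span_scale vec.span_base imageI)
  qed
  then have "vec.dim (columns A) \<le> card (?d ` B)"
    using vec.dim_le_card fB by blast
  also have "\<dots> \<le> card B" using fB card_image_le by blast
  finally show ?thesis using B(4) by (simp add: row_rank_def_gen)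
qed

lemma rank_transpose_field:
  fixes A :: "'a::field^'n^'m"
  shows "rank (transpose A) = rank A"
proof -
  have "rank (transpose A) \<le> rank A" for A :: "'a::field^'k^'l"
    using dim_columns_le_rank[of A] by (simp add: row_rank_def_gen)
  from this[of A] this[of "transpose A"] show ?thesis by simp
qed

lemma rank_eq_dim_range:
  fixes A :: "'a::field^'n^'m"
  shows "rank A = vec.dim (range ((*v) A))"
  using rank_transpose_field[of A] by (simp add: dim_range_eq_dim_columns row_rank_def_gen)

lemma vec_subspace_range:
  fixes A :: "'a::field^'n^'m"
  shows "vec.subspace (range ((*v) A))"
proof -
  have "x *s (A *v y) \<in> range ((*v) A)" for x y
    by (metis rangeI vector_scalar_commute)
  moreover have "A *v x + A *v y \<in> range ((*v) A)" for x y
    by (metis matrix_vector_right_distrib rangeI)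
  moreover have "0 \<in> range ((*v) A)" by (metis matrix_vector_mult_0_right rangeI)
  ultimately show ?thesis by (auto simp: vec.subspace_def)
qed

lemma rank_le_if_range_subset:
  fixes A :: "'a::field^'n^'m" and B :: "'a::field^'k^'m"
  assumes "range ((*v) A) \<subseteq> range ((*v) B)"
  shows "rank A \<le> rank B"
  using assms by (simp add: rank_eq_dim_range vec.dim_subset)

lemma rank_mult_le_left:
  fixes A :: "'a::field^'n^'m"
  shows "rank (A ** B) \<le> rank A"
  by (rule rank_le_if_range_subset) (auto simp: matrix_vector_mul_assoc[symmetric])

lemma rank_mult_le_right:
  fixes A :: "'a::field^'n^'m"
  shows "rank (A ** B) \<le> rank B"
  using rank_mult_le_left[of "transpose B" "transpose A"]
  by (simp add: matrix_transpose_mul[symmetric] rank_transpose_field)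

lemma rank_add_le:
  fixes A B :: "'a::field^'n^'m"
  shows "rank (A + B) \<le> rank A + rank B"
proof -
  let ?S = "range ((*v) A)" and ?T = "range ((*v) B)"
  have "range ((*v) (A + B)) \<subseteq> {x + y |x y. x \<in> ?S \<and> y \<in> ?T}"
    by (auto simp: matrix_vector_mult_add_rdistrib)
  then have "rank (A + B) \<le> vec.dim {x + y |x y. x \<in> ?S \<and> y \<in> ?T}"
    by (simp add: rank_eq_dim_range vec.dim_subset)
  also have "\<dots> \<le> rank A + rank B"
    using vec.dim_sums_Int[OF vec_subspace_range[of A] vec_subspace_range[of B]]
    by (simp add: rank_eq_dim_range)
  finally show ?thesis .
qed

lemma rank_zero_field [simp]: "rank (0 :: 'a::field^'n^'m) = 0"
  by (auto simp: rank_eq_dim_range)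

lemma rank_le_1:
  fixes A :: "'a::field^'n^'m"
  assumes "\<And>v. \<exists>c. A *v v = c *s u"
  shows "rank A \<le> 1"
proof -
  have "range ((*v) A) \<subseteq> vec.span {u}"
    using assms by (fastforce simp: vec.span_singleton)
  then show ?thesis
    using vec.dim_le_card[of _ "{u}"] by (auto simp: rank_eq_dim_range)
qed

text \<open>Multiplying by \<open>proj W\<close> on both sides zeroes all entries outside \<open>W \<times> W\<close>, which leaves the rank of the
  principal submatrix on \<open>W\<close> without changing the index type.\<close>

definition proj :: "'n set \<Rightarrow> 'a::field^'n^'n" where
  "proj W = (\<chi> i j. if i = j then if i \<in> W then 1 else 0 else 0)"

lemma proj_mult_vec: "proj W *v v = (\<chi> i. if i \<in> W then v $ i else 0)"
  by (auto simp: proj_def vec_eq_iff matrix_vector_mult_def if_distrib[where f="\<lambda>x. x * _"]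
     cong: if_cong)

lemma transpose_proj [simp]: "transpose (proj W) = proj W"
  by (auto simp: transpose_def proj_def vec_eq_iff)

lemma proj_mult_left: "proj W ** A = (\<chi> i j. if i \<in> W then A $ i $ j else 0)"
  by (auto simp: proj_def vec_eq_iff matrix_matrix_mult_def if_distrib[where f="\<lambda>x. x * _"]
     cong: if_cong)

lemma proj_mult_right: "A ** proj W = (\<chi> i j. if j \<in> W then A $ i $ j else 0)"
  by (auto simp: proj_def vec_eq_iff matrix_matrix_mult_def if_distrib[where f="\<lambda>x. _ * x"]
     cong: if_cong)

section \<open>Rank under deletion of one index\<close>

lemma rank_proj_Compl_less:
  fixes A :: "'a::field^'n^'n"
  assumes "A *v w = c *s axis y 1" "c \<noteq> 0"
  shows "rank (proj (- {y}) ** A) + 1 \<le> rank A"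
proof -
  let ?S = "range ((*v) (proj (- {y}) ** A))"
  have ax: "axis y 1 \<in> range ((*v) A)"
  proof -
    have "A *v (inverse c *s w) = axis y 1"
      using assms by (simp add: vector_scalar_commute)
    then show ?thesis by (metis rangeI)
  qed
  \<comment> \<open>Zeroing coordinate \<open>y\<close> subtracts a multiple of the unit vector at
    \<open>y\<close>, which is in the range. The new range thus lies in the old one and misses that
    unit vector.\<close>
  have "?S \<subseteq> range ((*v) A)"
  proof clarify
    fix v
    have "(proj (- {y}) ** A) *v v = A *v v - ((A *v v) $ y) *s axis y 1"
      by (auto simp: matrix_vector_mul_assoc[symmetric] proj_mult_vec vec_eq_iff axis_def)
    also have "\<dots> \<in> range ((*v) A)"
      using ax by (intro vec.subspace_diff vec_subspace_range vec.subspace_scale) auto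
    finally show "(proj (- {y}) ** A) *v v \<in> range ((*v) A)" .
  qed
  then have "vec.dim (insert (axis y 1) ?S) \<le> rank A"
    using ax by (auto simp: rank_eq_dim_range intro!: vec.dim_subset)
  moreover have "axis y 1 \<notin> vec.span ?S"
  proof
    assume "axis y 1 \<in> vec.span ?S"
    then have "axis y 1 \<in> ?S" using vec.span_eq_iff vec_subspace_range by blast
    then obtain v where "axis y (1::'a) = (proj (- {y}) ** A) *v v" by blast
    from arg_cong[OF this, of "\<lambda>v. v $ y"] show False
      by (simp add: matrix_vector_mul_assoc[symmetric] proj_mult_vec axis_def)
  qed
  ultimately show ?thesis
    by (simp add: vec.dim_insert rank_eq_dim_range)
qed

text \<open>Since \<open>w $ y = 0\<close>, zeroing column \<open>y\<close> leaves the image of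
  \<open>w\<close> unchanged, so the row can still be removed at the cost of one afterwards;
  \<open>w'\<close> gives the other unit for the column.\<close>

lemma rank_delete_drop2:
  fixes A :: "'a::field^'n^'n"
  assumes w: "A *v w = c *s axis y 1" "c \<noteq> 0" "w $ y = 0"
    and w': "transpose A *v w' = c' *s axis y 1" "c' \<noteq> 0"
  shows "rank (proj (- {y}) ** A ** proj (- {y})) + 2 \<le> rank A"
proof -
  let ?P = "proj (- {y}) :: 'a^'n^'n"
  have "(A ** ?P) *v w = c *s axis y 1"
  proof -
    have "?P *v w = w" using w(3) by (auto simp: proj_mult_vec vec_eq_iff)
    then show ?thesis using w by (simp add: matrix_vector_mul_assoc[symmetric])
  qed
  from rank_proj_Compl_less[OF this w(2)]
  have "rank (?P ** A ** ?P) + 1 \<le> rank (A ** ?P)" by (simp add: matrix_mul_assoc)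
  moreover have "rank (A ** ?P) = rank (?P ** transpose A)"
    using rank_transpose_field[of "A ** ?P"] by (simp add: matrix_transpose_mul)
  moreover have "rank (?P ** transpose A) + 1 \<le> rank (transpose A)"
    by (rule rank_proj_Compl_less[OF w'])
  ultimately show ?thesis by (simp add: rank_transpose_field)
qed

text \<open>The null vector expresses column \<open>x\<close> through the other columns.\<close>

lemma rank_eq_delete_column:
  fixes A :: "'a::field^'n^'n"
  assumes "A *v w = 0" "w $ x \<noteq> 0"
  shows "rank (A ** proj (- {x})) = rank A"
proof (rule antisym[OF rank_mult_le_left rank_le_if_range_subset], clarify)
  fix v
  have "A *v v = A *v (v - (v $ x / w $ x) *s w)"
    using assms by (simp add: matrix_vector_mult_diff_distrib vector_scalar_commute)
  also have "v - (v $ x / w $ x) *s w = proj (- {x}) *v (v - (v $ x / w $ x) *s w)"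
    using assms by (auto simp: proj_mult_vec vec_eq_iff)
  finally show "A *v v \<in> range ((*v) (A ** proj (- {x})))"
    by (metis matrix_vector_mul_assoc rangeI)
qed

lemma rank_eq_delete:
  fixes A :: "'a::field^'n^'n"
  assumes "A *v w = 0" "w $ x \<noteq> 0" "transpose A *v w' = 0" "w' $ x \<noteq> 0"
  shows "rank (proj (- {x}) ** A ** proj (- {x})) = rank A"
proof -
  let ?P = "proj (- {x}) :: 'a^'n^'n"
  have "rank (?P ** A ** ?P) = rank (?P ** transpose A ** ?P)"
    using rank_transpose_field[of "?P ** A ** ?P"] by (simp add: matrix_transpose_mul matrix_mul_assoc)
  also have "\<dots> = rank (?P ** transpose A)"
    using assms(3,4) by (intro rank_eq_delete_column[of _ w'])
      (simp_all add: matrix_vector_mul_assoc[symmetric])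
  also have "\<dots> = rank (A ** ?P)"
    using rank_transpose_field[of "A ** ?P"] by (simp add: matrix_transpose_mul)
  also have "\<dots> = rank A" by (rule rank_eq_delete_column[OF assms(1,2)])
  finally show ?thesis .
qed

text \<open>Equal rank forces column \<open>x\<close> into the span of the other columns, and the
  dependency is the null vector.\<close>

lemma null_vector_if_rank_eq:
  fixes A :: "'a::field^'n^'n"
  assumes "rank A \<le> rank (proj (- {x}) ** A ** proj (- {x}))"
  shows "\<exists>w. A *v w = 0 \<and> w $ x \<noteq> 0"
proof -
  let ?P = "proj (- {x}) :: 'a^'n^'n"
  have "rank A \<le> rank (A ** ?P)"
    using assms rank_mult_le_right[of ?P "A ** ?P"] by (simp add: matrix_mul_assoc)
  moreover have "range ((*v) (A ** ?P)) \<subseteq> range ((*v) A)"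
    by (auto simp: matrix_vector_mul_assoc[symmetric])
  ultimately have "range ((*v) (A ** ?P)) = range ((*v) A)"
    by (intro vec.subspace_dim_equal vec_subspace_range) (auto simp: rank_eq_dim_range)
  then obtain u where u: "A *v axis x 1 = (A ** ?P) *v u" by (metis imageE rangeI)
  have "A *v (axis x 1 - ?P *v u) = 0"
    using u by (simp add: matrix_vector_mult_diff_distrib matrix_vector_mul_assoc)
  moreover have "(axis x 1 - ?P *v u) $ x \<noteq> 0"
    by (simp add: proj_mult_vec axis_def)
  ultimately show ?thesis by blast
qed

text \<open>The ranges of the two diagonal blocks are supported on complementary sets, hence meet
  only in 0, and both lie in the range of the whole matrix.\<close>

lemma rank_block_le:
  fixes A :: "'a::field^'n^'n"
  assumes "\<And>i j. (i \<in> W) \<noteq> (j \<in> W) \<Longrightarrow> A $ i $ j = 0"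
  shows "rank (proj W ** A ** proj W) + rank (proj (- W) ** A ** proj (- W)) \<le> rank A"
proof -
  let ?A = "A ** proj W" and ?B = "A ** proj (- W)"
  let ?S = "range ((*v) ?A)" and ?T = "range ((*v) ?B)"
  have eq: "proj W ** A ** proj W = ?A" "proj (- W) ** A ** proj (- W) = ?B"
    using assms by (auto simp: proj_mult_left proj_mult_right vec_eq_iff)
  have v: "(?A *v v) $ i = 0" if "i \<notin> W" for v i
    by (subst eq(1)[symmetric]) (simp add: that proj_mult_vec flip: matrix_vector_mul_assoc)
  have v': "(?B *v v) $ i = 0" if "i \<in> W" for v i
    by (subst eq(2)[symmetric]) (simp add: that proj_mult_vec flip: matrix_vector_mul_assoc)
  have "z = 0" if "z \<in> ?S \<inter> ?T" for z
  proof (subst vec_eq_iff, safe)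
    fix i show "z $ i = 0 $ i" using that v v' by (cases "i \<in> W") auto
  qed
  then have "?S \<inter> ?T \<subseteq> {0}" by blast
  then have "vec.dim (?S \<inter> ?T) = 0" by (simp add: vec.dim_eq_0)
  moreover have "{x + y |x y. x \<in> ?S \<and> y \<in> ?T} \<subseteq> range ((*v) A)"
    by (auto simp: matrix_vector_mul_assoc[symmetric] matrix_vector_right_distrib[symmetric])
  then have "vec.dim {x + y |x y. x \<in> ?S \<and> y \<in> ?T} \<le> rank A"
    by (simp add: rank_eq_dim_range vec.dim_subset)
  ultimately show ?thesis
    using vec.dim_sums_Int[OF vec_subspace_range[of ?A] vec_subspace_range[of ?B]]
    unfolding eq rank_eq_dim_range by linarith
qed

lemma rank_delete_ge:
  fixes A :: "'a::field^'n^'n"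
  shows "rank A \<le> rank (proj (- {x}) ** A ** proj (- {x})) + 2"
proof -
  let ?P = "proj (- {x}) :: 'a^'n^'n" and ?Q = "proj {x} :: 'a^'n^'n"
  have Q: "rank ?Q \<le> 1"
    by (rule rank_le_1[where u = "axis x 1"])
       (auto simp: proj_mult_vec vec_eq_iff axis_def)
  have "A = ?P ** A ** ?P + ?P ** A ** ?Q + ?Q ** A"
    by (auto simp: proj_mult_left proj_mult_right vec_eq_iff)
  then have "rank A = rank (?P ** A ** ?P + ?P ** A ** ?Q + ?Q ** A)" by (rule arg_cong)
  then have "rank A \<le> rank (?P ** A ** ?P) + rank (?P ** A ** ?Q) + rank (?Q ** A)"
    using rank_add_le[of "?P ** A ** ?P + ?P ** A ** ?Q" "?Q ** A"]
      rank_add_le[of "?P ** A ** ?P" "?P ** A ** ?Q"] by linarith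
  moreover have "rank (?P ** A ** ?Q) \<le> 1" "rank (?Q ** A) \<le> 1"
    using rank_mult_le_right[of "?P ** A" ?Q] rank_mult_le_left[of ?Q A] Q by linarith+
  ultimately show ?thesis by linarith
qed

subsection \<open>Cycles, bridges and the cyclomatic number\<close>

text \<open>Vertices outside \<open>W\<close> stay in the graph as isolated vertices. This keeps the vertex type fixed and is harmless:
  rank, cover number and cyclomatic number ignore isolated vertices.\<close>

definition restr :: "('n \<Rightarrow> 'n \<Rightarrow> bool) \<Rightarrow> 'n set \<Rightarrow> 'n \<Rightarrow> 'n \<Rightarrow> bool" where
  "restr adj W u v \<longleftrightarrow> adj u v \<and> u \<in> W \<and> v \<in> W"

definition del :: "('n \<Rightarrow> 'n \<Rightarrow> bool) \<Rightarrow> 'n \<Rightarrow> 'n \<Rightarrow> 'n \<Rightarrow> 'n \<Rightarrow> bool" where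
  "del adj a b u v \<longleftrightarrow> adj u v \<and> {u, v} \<noteq> {a, b}"

definition cyc_edge :: "('n \<Rightarrow> 'n \<Rightarrow> bool) \<Rightarrow> 'n \<Rightarrow> 'n \<Rightarrow> bool" where
  "cyc_edge adj u v \<longleftrightarrow> (\<exists>cs. is_cycle adj cs \<and> {u, v} \<in> cycle_edges cs)"

definition on_cycle :: "('n \<Rightarrow> 'n \<Rightarrow> bool) \<Rightarrow> 'n \<Rightarrow> bool" where
  "on_cycle adj v \<longleftrightarrow> (\<exists>cs. is_cycle adj cs \<and> v \<in> set cs)"

lemma simple_graph_sym: "simple_graph adj \<Longrightarrow> adj u v \<Longrightarrow> adj v u"
  and simple_graph_irrefl: "simple_graph adj \<Longrightarrow> \<not> adj u u"
  by (auto simp: simple_graph_def)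

lemma simple_graph_restr: "simple_graph adj \<Longrightarrow> simple_graph (restr adj W)"
  and simple_graph_del: "simple_graph adj \<Longrightarrow> simple_graph (del adj a b)"
  by (auto simp: simple_graph_def restr_def del_def)

lemma restr_le: "restr adj W \<le> adj" and del_le: "del adj a b \<le> adj"
  by (auto simp: restr_def del_def)

lemma restr_restr: "restr (restr adj V) W = restr adj (V \<inter> W)"
  by (auto simp: restr_def fun_eq_iff)

lemma del_commute: "del adj a b = del adj b a"
  by (auto simp: del_def fun_eq_iff)

lemma rtranclp_sym: "simple_graph adj \<Longrightarrow> adj\<^sup>*\<^sup>* u v \<Longrightarrow> adj\<^sup>*\<^sup>* v u"
  by (metis simple_graph_sym symp_def symp_rtranclp sympI sympD)

lemma is_cycle_mono: "h \<le> g \<Longrightarrow> is_cycle h cs \<Longrightarrow> is_cycle g cs"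
  by (auto simp: is_cycle_def)

lemma cyc_edge_mono: "h \<le> g \<Longrightarrow> cyc_edge h u v \<Longrightarrow> cyc_edge g u v"
  using is_cycle_mono by (auto simp: cyc_edge_def)

lemma on_cycle_mono: "h \<le> g \<Longrightarrow> on_cycle h u \<Longrightarrow> on_cycle g u"
  using is_cycle_mono by (auto simp: on_cycle_def)

lemma is_cycle_restr_iff: "is_cycle (restr adj W) cs \<longleftrightarrow> is_cycle adj cs \<and> set cs \<subseteq> W"
proof -
  have "set cs \<subseteq> W \<longleftrightarrow> (\<forall>i<length cs. cs ! i \<in> W)" by (metis in_set_conv_nth subset_iff)
  moreover have "length cs \<ge> 3 \<Longrightarrow> (i + 1) mod length cs < length cs" for i
    by (rule mod_less_divisor) auto
  ultimately show ?thesis unfolding is_cycle_def restr_def by auto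
qed

lemma is_cycle_del: "is_cycle adj cs \<Longrightarrow> {a, b} \<notin> cycle_edges cs \<Longrightarrow> is_cycle (del adj a b) cs"
  by (auto simp: is_cycle_def del_def cycle_edges_def)

lemma cycle_edges_D:
  assumes "is_cycle adj cs" "simple_graph adj" "{a, b} \<in> cycle_edges cs"
  shows "adj a b" "a \<in> set cs" "b \<in> set cs"
proof -
  obtain i where i: "i < length cs" "{a, b} = {cs ! i, cs ! ((i + 1) mod length cs)}"
    using assms(3) by (auto simp: cycle_edges_def)
  have "(i + 1) mod length cs < length cs" using i by (intro mod_less_divisor) auto
  moreover have "adj (cs ! i) (cs ! ((i + 1) mod length cs))"
    using assms(1) i by (auto simp: is_cycle_def)
  ultimately show "adj a b" "a \<in> set cs" "b \<in> set cs"
    using i simple_graph_sym[OF assms(2)] by (auto simp: doubleton_eq_iff)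
qed

lemma cycle_edge_at:
  assumes "x \<in> set cs"
  shows "\<exists>b. {x, b} \<in> cycle_edges cs"
  using assms by (auto simp: cycle_edges_def in_set_conv_nth)

lemma cycle_hd_in: "is_cycle adj cs \<Longrightarrow> cs ! 0 \<in> set cs"
  unfolding is_cycle_def by (intro nth_mem) linarith

lemma set_cycle_edges: "set cs = \<Union> (cycle_edges cs)"
proof
  show "set cs \<subseteq> \<Union> (cycle_edges cs)" by (meson UnionI cycle_edge_at insertI1 subsetI)
  show "\<Union> (cycle_edges cs) \<subseteq> set cs"
  proof
    fix x assume "x \<in> \<Union> (cycle_edges cs)"
    then obtain i where i: "i < length cs" "x = cs ! i \<or> x = cs ! ((i + 1) mod length cs)"
      by (auto simp: cycle_edges_def)
    moreover have "(i + 1) mod length cs < length cs" using i by (intro mod_less_divisor) auto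
    ultimately show "x \<in> set cs" by auto
  qed
qed

lemma rotate_nth_succ:
  assumes "i < length cs"
  shows "rotate n cs ! i = cs ! ((n + i) mod length cs)"
    and "rotate n cs ! ((i + 1) mod length cs) = cs ! (((n + i) mod length cs + 1) mod length cs)"
proof -
  have "(i + 1) mod length cs < length cs" using assms by (intro mod_less_divisor) auto
  then show "rotate n cs ! ((i + 1) mod length cs) = cs ! (((n + i) mod length cs + 1) mod length cs)"
    by (simp add: nth_rotate mod_simps add.assoc)
qed (use assms in \<open>simp add: nth_rotate\<close>)

lemma is_cycle_rotate:
  assumes "is_cycle adj cs" shows "is_cycle adj (rotate n cs)"
proof -
  have "(n + i) mod length cs < length cs" if "i < length cs" for i
    using that by (intro mod_less_divisor) auto
  then show ?thesis
    using assms rotate_nth_succ[of _ cs n] unfolding is_cycle_def by (metis distinct_rotate length_rotate)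
qed

lemma cycle_edges_rotate: "cycle_edges (rotate n cs) = cycle_edges cs"
proof -
  have sub: "cycle_edges (rotate n cs) \<subseteq> cycle_edges cs" for n and cs :: "'a list"
  proof
    fix e assume "e \<in> cycle_edges (rotate n cs)"
    then obtain i where i: "i < length cs"
      "e = {rotate n cs ! i, rotate n cs ! ((i + 1) mod length cs)}" by (auto simp: cycle_edges_def)
    have "(n + i) mod length cs < length cs"
      using i by (intro mod_less_divisor) auto
    then show "e \<in> cycle_edges cs" unfolding cycle_edges_def i(2) rotate_nth_succ[OF i(1)] by blast
  qed
  have "rotate (length cs - n mod length cs) (rotate n cs) = cs"
  proof (cases "cs = []")
    case False
    then have "(length cs - n mod length cs + n mod length cs) mod length cs = 0"
      by (metis le_add_diff_inverse2 length_greater_0_conv mod_less_divisor mod_self nat_less_le)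
    then show ?thesis by (simp add: rotate_rotate rotate_id mod_simps)
  qed simp
  then show ?thesis using sub by (metis subset_antisym)
qed

lemma cycle_start_at:
  assumes "is_cycle adj cs" "x \<in> set cs"
  obtains cs' where "is_cycle adj cs'" "cs' ! 0 = x" "set cs' = set cs" "cycle_edges cs' = cycle_edges cs"
    "length cs' = length cs"
proof -
  obtain i where "i < length cs" "cs ! i = x" using assms(2) by (auto simp: in_set_conv_nth)
  then have "rotate i cs ! 0 = x" by (subst nth_rotate) auto
  then show ?thesis using that[of "rotate i cs"] is_cycle_rotate[OF assms(1)] by (simp add: cycle_edges_rotate)
qed

lemma cycle_walk:
  assumes "is_cycle adj cs" "k < length cs"
  shows "(del adj (last cs) (cs ! 0))\<^sup>*\<^sup>* (cs ! 0) (cs ! k)"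
  using assms(2)
proof (induction k)
  case (Suc k)
  have l: "length cs \<ge> 3" "distinct cs" using assms(1) by (auto simp: is_cycle_def)
  have "adj (cs ! k) (cs ! ((k + 1) mod length cs))"
    using assms(1) Suc.prems Suc_lessD unfolding is_cycle_def by blast
  then have "adj (cs ! k) (cs ! Suc k)" using Suc.prems by simp
  moreover have "{cs ! k, cs ! Suc k} \<noteq> {last cs, cs ! 0}"
  proof -
    have "last cs = cs ! (length cs - 1)" using l by (intro last_conv_nth) auto
    moreover have "cs ! Suc k \<noteq> cs ! 0"
      using l Suc.prems by (subst nth_eq_iff_index_eq) auto
    moreover have "cs ! k \<noteq> cs ! (length cs - 1)"
      using l Suc.prems by (subst nth_eq_iff_index_eq) auto
    moreover have "cs ! Suc k \<noteq> cs ! (length cs - 1) \<or> cs ! k \<noteq> cs ! 0"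
      using l Suc.prems by (subst (1 2) nth_eq_iff_index_eq) auto
    ultimately show ?thesis by (auto simp: doubleton_eq_iff)
  qed
  ultimately have "del adj (last cs) (cs ! 0) (cs ! k) (cs ! Suc k)" by (simp add: del_def)
  then show ?case using Suc by (metis Suc_lessD rtranclp.simps)
qed simp

text \<open>Induction along a cycle: local closure is propagated all the way around. It serves to
  compare two cycles, to confine a cycle to one side of a bridge, and to connect the ends of a
  chord.\<close>

lemma cycle_closed:
  assumes cs: "is_cycle adj cs" and x: "x \<in> set cs" "x \<in> X"
    and closed: "\<And>a b. a \<in> X \<Longrightarrow> {a, b} \<in> cycle_edges cs \<Longrightarrow> b \<in> X"
  shows "set cs \<subseteq> X"
proof -
  obtain cs' where cs': "is_cycle adj cs'" "cs' ! 0 = x" "set cs' = set cs"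
    "cycle_edges cs' = cycle_edges cs" using cycle_start_at[OF cs x(1)] .
  have "cs' ! k \<in> X" if "k < length cs'" for k
    using that
  proof (induction k)
    case (Suc k)
    then have "{cs' ! k, cs' ! Suc k} \<in> cycle_edges cs'"
      unfolding cycle_edges_def by (auto intro!: exI[of _ k])
    then show ?case using Suc closed cs'(4) by auto
  qed (use cs' x in simp)
  then show ?thesis using cs'(3) by (metis in_set_conv_nth subsetI)
qed

lemma rtranclp_distinct_path:
  assumes "R\<^sup>*\<^sup>* u v"
  shows "\<exists>p. p \<noteq> [] \<and> hd p = u \<and> last p = v \<and> distinct p \<and> (\<forall>i. Suc i < length p \<longrightarrow> R (p ! i) (p ! Suc i))"
  using assms
proof (induction rule: rtranclp_induct)
  case base
  show ?case by (rule exI[of _ "[u]"]) auto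
next
  case (step y z)
  then obtain p where p: "p \<noteq> []" "hd p = u" "last p = y" "distinct p"
    "\<And>i. Suc i < length p \<Longrightarrow> R (p ! i) (p ! Suc i)" by blast
  show ?case
  proof (cases "z \<in> set p")
    case True
    then obtain j where j: "j < length p" "p ! j = z" by (auto simp: in_set_conv_nth)
    then have "last (take (Suc j) p) = z" by (simp add: take_Suc_conv_app_nth)
    then show ?thesis using p j by (intro exI[of _ "take (Suc j) p"]) auto
  next
    case False
    have "R ((p @ [z]) ! i) ((p @ [z]) ! Suc i)" if "Suc i < length (p @ [z])" for i
    proof (cases "Suc i < length p")
      case True then show ?thesis using p(5) by (auto simp: nth_append)
    next
      case False
      then have "Suc i = length p" using that by simp
      moreover from this have "p ! i = y" using p(1,3) by (metis diff_Suc_1 last_conv_nth)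
      ultimately show ?thesis using step.hyps(2) by (auto simp: nth_append)
    qed
    then show ?thesis using p False by (intro exI[of _ "p @ [z]"]) auto
  qed
qed

text \<open>An edge lies on a cycle iff it is not a bridge: a cycle minus the edge is a detour, and
  a shortest-form detour closes up with the edge.\<close>

lemma cyc_edge_iff:
  assumes g: "simple_graph adj" and uv: "adj u v"
  shows "cyc_edge adj u v \<longleftrightarrow> (del adj u v)\<^sup>*\<^sup>* u v"
proof
  assume "cyc_edge adj u v"
  then obtain cs i where cs: "is_cycle adj cs" and i: "i < length cs"
    "{u, v} = {cs ! i, cs ! ((i + 1) mod length cs)}"
    by (auto simp: cyc_edge_def cycle_edges_def)
  \<comment> \<open>This rotation makes the given edge the closing edge, so
    \<open>cycle_walk\<close> runs around the cycle without it.\<close>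
  let ?cs = "rotate (i + 1) cs"
  have c: "is_cycle adj ?cs" by (rule is_cycle_rotate[OF cs])
  have l: "length cs \<ge> 3" using cs by (simp add: is_cycle_def)
  have "?cs ! 0 = cs ! ((i + 1) mod length cs)" using i by (subst nth_rotate) auto
  moreover have lst: "last ?cs = ?cs ! (length cs - 1)" using l by (subst last_conv_nth) auto
  then have "last ?cs = cs ! ((i + 1 + (length cs - 1)) mod length cs)"
    using l by (subst (asm) nth_rotate) auto
  moreover have "i + 1 + (length cs - 1) = i + length cs" using l by simp
  ultimately have "?cs ! 0 = cs ! ((i + 1) mod length cs)" "last ?cs = cs ! i" using i by simp_all
  moreover have "(del adj (last ?cs) (?cs ! 0))\<^sup>*\<^sup>* (?cs ! 0) (last ?cs)"
  proof -
    have "?cs \<noteq> []" "length cs - 1 < length ?cs" using l by auto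
    then show ?thesis using cycle_walk[OF c, of "length cs - 1"] unfolding lst by (simp only: length_rotate)
  qed
  ultimately have "(del adj (cs ! i) (cs ! ((i + 1) mod length cs)))\<^sup>*\<^sup>* (cs ! ((i + 1) mod length cs)) (cs ! i)"
    by simp
  then show "(del adj u v)\<^sup>*\<^sup>* u v"
    using i(2) rtranclp_sym[OF simple_graph_del[OF g]] by (metis del_commute doubleton_eq_iff)
next
  assume "(del adj u v)\<^sup>*\<^sup>* u v"
  then obtain p where p: "p \<noteq> []" "hd p = u" "last p = v" "distinct p"
    "\<And>i. Suc i < length p \<Longrightarrow> del adj u v (p ! i) (p ! Suc i)"
    using rtranclp_distinct_path[OF \<open>(del adj u v)\<^sup>*\<^sup>* u v\<close>] by blast
  have hd: "p ! 0 = u" using p by (simp add: hd_conv_nth)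
  have lst: "p ! (length p - 1) = v" using p by (simp add: last_conv_nth)
  \<comment> \<open>Length 1 would make the edge a loop, length 2 would use the deleted edge itself;
    from length 3 on the path closes to a cycle.\<close>
  have "length p \<noteq> 1" using hd lst uv g by (auto simp: simple_graph_def)
  moreover have "length p \<noteq> 2" using hd lst p(5)[of 0] by (auto simp: del_def)
  ultimately have l: "length p \<ge> 3" using p(1) by (cases "length p") auto
  have "adj (p ! i) (p ! ((i + 1) mod length p))" if "i < length p" for i
  proof (cases "Suc i < length p")
    case True then show ?thesis using p(5)[of i] by (auto simp: del_def)
  next
    case False
    then have "i + 1 = length p" using that by simp
    then have "i = length p - 1" "(i + 1) mod length p = 0" by simp_all
    then show ?thesis using hd lst simple_graph_sym[OF g uv] by simp
  qed
  then have "is_cycle adj p" using p l by (auto simp: is_cycle_def)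
  moreover have "{u, v} \<in> cycle_edges p"
    using l hd lst p(1) unfolding cycle_edges_def by (auto intro!: exI[of _ "length p - 1"])
  ultimately show "cyc_edge adj u v" by (auto simp: cyc_edge_def)
qed

section \<open>Components and the cyclomatic number under deletion\<close>

lemma rtranclp_del:
  assumes g: "simple_graph adj" and uv: "adj u v"
  shows "adj\<^sup>*\<^sup>* a b \<longleftrightarrow> (del adj u v)\<^sup>*\<^sup>* a b \<or> (del adj u v)\<^sup>*\<^sup>* a u \<and> (del adj u v)\<^sup>*\<^sup>* v b
    \<or> (del adj u v)\<^sup>*\<^sup>* a v \<and> (del adj u v)\<^sup>*\<^sup>* u b" (is "_ = ?R b")
proof
  assume "adj\<^sup>*\<^sup>* a b"
  then show "?R b"
  proof (induction rule: rtranclp_induct)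
    case (step y z)
    show ?case
    proof (cases "{y, z} = {u, v}")
      case True
      then have "y = u \<and> z = v \<or> y = v \<and> z = u" by (auto simp: doubleton_eq_iff)
      then show ?thesis using step.IH by auto
    next
      case False
      then have "del adj u v y z" using step by (simp add: del_def)
      then show ?thesis using step.IH by (meson rtranclp.rtrancl_into_rtrancl)
    qed
  qed simp
next
  have "(del adj u v)\<^sup>*\<^sup>* x y \<Longrightarrow> adj\<^sup>*\<^sup>* x y" for x y
    by (rule predicate2D[OF rtranclp_mono[OF del_le]])
  then show "?R b \<Longrightarrow> adj\<^sup>*\<^sup>* a b"
    using uv simple_graph_sym[OF g uv] by (meson converse_rtranclp_into_rtranclp rtranclp_trans)
qed

text \<open>For a bridge, the classes \<open>C u\<close> and \<open>C v\<close> of the smaller graph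
  are distinct and merge into one class of \<open>adj\<close>, while all other classes
  persist.\<close>

lemma num_components_del:
  fixes adj :: "'n::finite \<Rightarrow> 'n \<Rightarrow> bool"
  assumes g: "simple_graph adj" and uv: "adj u v"
  shows "num_components (del adj u v) = num_components adj + (if cyc_edge adj u v then 0 else 1)"
proof (cases "cyc_edge adj u v")
  case True
  then have "(del adj u v)\<^sup>*\<^sup>* u v" using cyc_edge_iff[OF g uv] by simp
  moreover from this have "(del adj u v)\<^sup>*\<^sup>* v u" using rtranclp_sym simple_graph_del[OF g] by metis
  ultimately have "adj\<^sup>*\<^sup>* a b \<longleftrightarrow> (del adj u v)\<^sup>*\<^sup>* a b" for a b
    unfolding rtranclp_del[OF g uv, of a b] by (meson rtranclp_trans)
  then show ?thesis using True by (simp add: num_components_def)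
next
  case False
  let ?D = "(del adj u v)\<^sup>*\<^sup>*" 
  define C where "C a = {b. ?D a b}" for a
  have nuv: "\<not> ?D u v" using False cyc_edge_iff[OF g uv] by simp
  have sym: "?D a b \<Longrightarrow> ?D b a" for a b using rtranclp_sym simple_graph_del[OF g] by metis
  have C_eq: "C a = C b \<longleftrightarrow> ?D a b" for a b
    unfolding C_def using sym by (auto intro: rtranclp_trans)
  have A: "{b. adj\<^sup>*\<^sup>* a b} = (if a \<in> C u \<union> C v then C u \<union> C v else C a)" for a
    unfolding rtranclp_del[OF g uv, of a] C_def
    using sym by (auto intro: rtranclp_trans)
  have Q': "UNIV // {(a, b). ?D a b} = range C"
    by (auto simp: quotient_def C_def Image_def)
  have Q: "UNIV // {(a, b). adj\<^sup>*\<^sup>* a b} = insert (C u \<union> C v) (range C - {C u, C v})"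
  proof -
    have "UNIV // {(a, b). adj\<^sup>*\<^sup>* a b} = range (\<lambda>a. if a \<in> C u \<union> C v then C u \<union> C v else C a)"
      unfolding A[symmetric] by (auto simp: quotient_def Image_def)
    also have "\<dots> = insert (C u \<union> C v) (range C - {C u, C v})"
    proof -
      have "u \<in> C u \<union> C v" by (simp add: C_def)
      moreover have "a \<in> C u \<union> C v \<longleftrightarrow> C a = C u \<or> C a = C v" for a
        unfolding C_eq using sym by (auto simp: C_def)
      ultimately show ?thesis by (auto split: if_splits)
    qed
    finally show ?thesis .
  qed
  have "C u \<union> C v \<notin> range C"
  proof
    assume "C u \<union> C v \<in> range C"
    then obtain a where "C u \<union> C v = C a" by blast
    then have "?D a u" "?D a v" by (auto simp: C_def)
    then show False using nuv sym by (meson rtranclp_trans)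
  qed
  then have "card (insert (C u \<union> C v) (range C - {C u, C v})) = Suc (card (range C - {C u, C v}))"
    by simp
  also have "card (range C - {C u, C v}) = card (range C) - 2"
    using nuv C_eq by (subst card_Diff_subset) auto
  finally have "num_components adj = Suc (card (range C) - 2)"
    unfolding num_components_def Q .
  moreover have "card (range C) \<ge> 2"
  proof -
    have "card {C u, C v} \<le> card (range C)" by (rule card_mono) auto
    then show ?thesis using nuv C_eq by simp
  qed
  ultimately show ?thesis using False by (simp add: num_components_def Q')
qed

lemma finite_edges [simp]: "finite (edges (adj :: 'n::finite \<Rightarrow> 'n \<Rightarrow> bool))"
  by (rule finite_subset[of _ UNIV]) auto

lemma edges_del:
  assumes "simple_graph adj" "adj u v"
  shows "edges (del adj u v) = edges adj - {{u, v}}" "{u, v} \<in> edges adj"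
  using assms by (auto simp: edges_def del_def)

lemma card_edges_del:
  fixes adj :: "'n::finite \<Rightarrow> 'n \<Rightarrow> bool"
  assumes "simple_graph adj" "adj u v"
  shows "card (edges adj) = Suc (card (edges (del adj u v)))"
  using edges_del[OF assms] by (metis card_Suc_Diff1 finite_edges)

lemma card_edges_mono:
  fixes g h :: "'n::finite \<Rightarrow> 'n \<Rightarrow> bool"
  shows "h \<le> g \<Longrightarrow> card (edges h) \<le> card (edges g)"
  by (rule card_mono) (auto simp: edges_def)

lemma card_edges_less:
  fixes g h :: "'n::finite \<Rightarrow> 'n \<Rightarrow> bool"
  assumes "simple_graph g" "simple_graph h" "h \<le> g" "g u v" "\<not> h u v"
  shows "card (edges h) < card (edges g)"
proof -
  have "h \<le> del g u v"
    using assms by (auto simp: del_def doubleton_eq_iff simple_graph_def)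
  then have "card (edges h) \<le> card (edges (del g u v))" by (rule card_edges_mono)
  then show ?thesis using card_edges_del[OF assms(1,4)] by simp
qed

lemma cyclomatic_del:
  fixes adj :: "'n::finite \<Rightarrow> 'n \<Rightarrow> bool"
  assumes "simple_graph adj" "adj u v"
  shows "cyclomatic (del adj u v) = cyclomatic adj - (if cyc_edge adj u v then 1 else 0)"
  using card_edges_del[OF assms] num_components_del[OF assms] by (simp add: cyclomatic_def)

lemma le_del:
  assumes "simple_graph h" "h \<le> g" "\<not> h u v"
  shows "h \<le> del g u v"
  using assms by (auto simp: del_def doubleton_eq_iff simple_graph_def)

lemma cyclomatic_mono:
  fixes g h :: "'n::finite \<Rightarrow> 'n \<Rightarrow> bool"
  assumes "simple_graph g" "simple_graph h" "h \<le> g"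
  shows "cyclomatic h \<le> cyclomatic g"
  using assms
proof (induction "card (edges g)" arbitrary: g rule: less_induct)
  case less
  show ?case
  proof (cases "h = g")
    case False
    then obtain u v where uv: "g u v" "\<not> h u v" using less.prems(3) by (auto simp: fun_eq_iff)
    have "cyclomatic h \<le> cyclomatic (del g u v)"
      using less.prems uv card_edges_del[of g u v]
      by (intro less.hyps le_del) (auto simp: simple_graph_del)
    then show ?thesis using cyclomatic_del[OF less.prems(1) uv(1)] by (auto split: if_splits)
  qed simp
qed

text \<open>Deleting edges creates no cycles, so the edges still to be removed remain bridges and no
  single removal changes the number.\<close>

lemma cyclomatic_remove_noncyclic:
  fixes g h :: "'n::finite \<Rightarrow> 'n \<Rightarrow> bool"
  assumes "simple_graph g" "simple_graph h" "h \<le> g"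
    and "\<And>u v. g u v \<Longrightarrow> \<not> h u v \<Longrightarrow> \<not> cyc_edge g u v"
  shows "cyclomatic h = cyclomatic g"
  using assms
proof (induction "card (edges g)" arbitrary: g rule: less_induct)
  case less
  show ?case
  proof (cases "h = g")
    case False
    then obtain u v where uv: "g u v" "\<not> h u v" using less.prems(3) by (auto simp: fun_eq_iff)
    have "cyclomatic h = cyclomatic (del g u v)"
    proof (rule less.hyps)
      fix a b assume "del g u v a b" "\<not> h a b"
      moreover from this have "g a b" by (simp add: del_def)
      ultimately show "\<not> cyc_edge (del g u v) a b"
        using less.prems(4)[of a b] cyc_edge_mono[OF del_le, of g u v a b] \<open>\<not> h a b\<close> by blast
    qed (use less.prems uv card_edges_del[of g u v] in \<open>auto simp: simple_graph_del le_del\<close>)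
    then show ?thesis using cyclomatic_del[OF less.prems(1) uv(1)] less.prems(4)[OF uv] by simp
  qed simp
qed

lemma cyclomatic_empty:
  fixes adj :: "'n::finite \<Rightarrow> 'n \<Rightarrow> bool"
  assumes "\<And>u v. \<not> adj u v"
  shows "cyclomatic adj = 0"
proof -
  have "adj\<^sup>*\<^sup>* u v \<longleftrightarrow> u = v" for u v
    using assms by (metis rtranclp.cases rtranclp.rtrancl_refl)
  then have "UNIV // {(u, v). adj\<^sup>*\<^sup>* u v} = range (\<lambda>x. {x})"
    by (auto simp: quotient_def Image_def)
  then have "num_components adj = CARD('n)"
    by (simp add: num_components_def card_image)
  moreover have "edges adj = {}" using assms by (auto simp: edges_def)
  ultimately show ?thesis by (simp add: cyclomatic_def)
qed

text \<open>Remove the edges of \<open>a\<close> from \<open>a\<close> and \<open>g\<close>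
  together: an edge on a cycle of \<open>a\<close> is on a cycle of \<open>g\<close>, so
  \<open>g\<close> loses at least as much as \<open>a\<close> at every removal.\<close>

lemma cyclomatic_superadd:
  fixes a b g :: "'n::finite \<Rightarrow> 'n \<Rightarrow> bool"
  assumes "simple_graph g" "simple_graph a" "simple_graph b" "a \<le> g" "b \<le> g"
    and "\<And>u v. a u v \<Longrightarrow> \<not> b u v"
  shows "cyclomatic a + cyclomatic b \<le> cyclomatic g"
  using assms
proof (induction "card (edges a)" arbitrary: a g rule: less_induct)
  case less
  show ?case
  proof (cases "\<exists>u v. a u v")
    case False
    then show ?thesis using cyclomatic_mono[OF less.prems(1,3,5)] cyclomatic_empty[of a] by simp
  next
    case True
    then obtain u v where uv: "a u v" by blast
    then have guv: "g u v" using less.prems by auto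
    have "cyclomatic (del a u v) + cyclomatic b \<le> cyclomatic (del g u v)"
      using less.prems uv card_edges_del[of a u v]
      by (intro less.hyps le_del) (auto simp: simple_graph_del del_def)
    then show ?thesis
      using cyclomatic_del[OF less.prems(2) uv] cyclomatic_del[OF less.prems(1) guv]
        cyc_edge_mono[OF less.prems(4), of u v] by (auto split: if_splits)
  qed
qed

text \<open>One edge at \<open>x\<close> lies on a cycle and already costs one; what else disappears
  cannot increase the number.\<close>

lemma cyclomatic_delete_on_cycle:
  fixes adj :: "'n::finite \<Rightarrow> 'n \<Rightarrow> bool"
  assumes g: "simple_graph adj" and x: "on_cycle adj x"
  shows "cyclomatic (restr adj (- {x})) \<le> cyclomatic adj - 1"
proof -
  obtain cs b where cs: "is_cycle adj cs" "x \<in> set cs" "{x, b} \<in> cycle_edges cs"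
    using x cycle_edge_at by (metis on_cycle_def)
  then have xb: "adj x b" "cyc_edge adj x b" using cycle_edges_D[OF _ g] by (auto simp: cyc_edge_def)
  have "cyclomatic (restr adj (- {x})) \<le> cyclomatic (del adj x b)"
    using g by (intro cyclomatic_mono le_del simple_graph_restr simple_graph_del) (auto simp: restr_def)
  then show ?thesis using cyclomatic_del[OF g xb(1)] xb(2) by simp
qed

text \<open>At a common vertex \<open>z\<close> where the cycles use different edges, deleting an
  edge of the first cycle costs one, and the second cycle still passes through \<open>z\<close>, so
  deleting \<open>z\<close> itself costs another.\<close>

lemma cyclomatic_delete_two_cycles:
  fixes adj :: "'n::finite \<Rightarrow> 'n \<Rightarrow> bool"
  assumes g: "simple_graph adj" and nd: "\<not> cycles_disjoint adj"
  shows "\<exists>x. on_cycle adj x \<and> cyclomatic (restr adj (- {x})) \<le> cyclomatic adj - 2"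
proof -
  have key: "\<exists>x. on_cycle adj x \<and> cyclomatic (restr adj (- {x})) \<le> cyclomatic adj - 2"
    if c: "is_cycle adj c1" "is_cycle adj c2" "z \<in> set c1" "z \<in> set c2"
      "{z, f} \<in> cycle_edges c1" "{z, f} \<notin> cycle_edges c2" for c1 c2 z f
  proof -
    let ?d = "del adj z f"
    have zf: "adj z f" "cyc_edge adj z f" using cycle_edges_D[OF c(1) g c(5)] c by (auto simp: cyc_edge_def)
    have "is_cycle ?d c2" using is_cycle_del c by metis
    then have "on_cycle ?d z" using c by (auto simp: on_cycle_def)
    then have "cyclomatic (restr ?d (- {z})) \<le> cyclomatic ?d - 1"
      by (rule cyclomatic_delete_on_cycle[OF simple_graph_del[OF g]])
    moreover have "restr ?d (- {z}) = restr adj (- {z})"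
      by (auto simp: restr_def del_def fun_eq_iff doubleton_eq_iff)
    moreover have "on_cycle adj z" using c by (auto simp: on_cycle_def)
    ultimately show ?thesis using cyclomatic_del[OF g zf(1)] zf(2) by auto
  qed
  obtain c1 c2 x where c: "is_cycle adj c1" "is_cycle adj c2" "cycle_edges c1 \<noteq> cycle_edges c2"
    "x \<in> set c1" "x \<in> set c2" using nd by (auto simp: cycles_disjoint_def)
  show ?thesis
  proof (rule ccontr)
    assume neg: "\<not> ?thesis"
    \<comment> \<open>If no vertex has that effect, the cycles use the same edges at every common
      vertex. This agreement spreads along either cycle and makes their edge sets equal.\<close>
    have agree: "{z, f} \<in> cycle_edges c1 \<longleftrightarrow> {z, f} \<in> cycle_edges c2" if "z \<in> set c1" "z \<in> set c2" for z f
      using neg key[OF c(1,2) that] key[OF c(2,1) that(2,1)] by metis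
    have half: "cycle_edges d1 \<subseteq> cycle_edges d2"
      if d: "is_cycle adj d1" "is_cycle adj d2" "x \<in> set d1" "x \<in> set d2"
        "\<And>z f. z \<in> set d1 \<Longrightarrow> z \<in> set d2 \<Longrightarrow> {z, f} \<in> cycle_edges d1 \<longleftrightarrow> {z, f} \<in> cycle_edges d2" for d1 d2
    proof -
      have "set d1 \<subseteq> set d1 \<inter> set d2"
      proof (rule cycle_closed[OF d(1) d(3)])
        show "x \<in> set d1 \<inter> set d2" using d(3,4) by simp
        fix a b assume ab: "a \<in> set d1 \<inter> set d2" "{a, b} \<in> cycle_edges d1"
        then have "{a, b} \<in> cycle_edges d2" using d(5) by simp
        then show "b \<in> set d1 \<inter> set d2"
          using cycle_edges_D(3)[OF d(1) g ab(2)] cycle_edges_D(3)[OF d(2) g] by simp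
      qed
      then have V: "set d1 \<subseteq> set d2" by blast
      show ?thesis
      proof
        fix e assume e: "e \<in> cycle_edges d1"
        then obtain a b where ab: "e = {a, b}" by (auto simp: cycle_edges_def)
        then have "a \<in> set d1" using e cycle_edges_D[OF d(1) g] by auto
        then show "e \<in> cycle_edges d2" using V d(5) e ab by blast
      qed
    qed
    have "cycle_edges c1 \<subseteq> cycle_edges c2" by (rule half) (use c agree in auto)
    moreover have "cycle_edges c2 \<subseteq> cycle_edges c1" by (rule half) (use c agree in auto)
    ultimately show False using c by auto
  qed
qed

text \<open>For a bridge \<open>xy\<close> this is the component of \<open>x\<close> that remains when the bridge is deleted. A minimal side contains
  no further bridge, so it is a single vertex (then \<open>x\<close> is pendant) or a single cycle.\<close>

definition side :: "('n \<Rightarrow> 'n \<Rightarrow> bool) \<Rightarrow> 'n \<Rightarrow> 'n \<Rightarrow> 'n set" where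
  "side adj x y = {z. (del adj x y)\<^sup>*\<^sup>* x z}"

lemma side_self: "x \<in> side adj x y" by (simp add: side_def)

lemma side_step:
  assumes "a \<in> side adj x y" "adj a b" "{a, b} \<noteq> {x, y}"
  shows "b \<in> side adj x y"
proof -
  have "del adj x y a b" using assms by (simp add: del_def)
  then show ?thesis using assms(1) by (auto simp: side_def intro: rtranclp.rtrancl_into_rtrancl)
qed

lemma side_other:
  assumes "simple_graph adj" "adj x y" "\<not> cyc_edge adj x y"
  shows "y \<notin> side adj x y"
  using cyc_edge_iff[OF assms(1,2)] assms(3) by (auto simp: side_def)

lemma side_leave:
  assumes "simple_graph adj" "adj x y" "\<not> cyc_edge adj x y"
    and "a \<in> side adj x y" "adj a b" "b \<notin> side adj x y"
  shows "a = x \<and> b = y"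
  using side_step[OF assms(4,5)] side_self[of x adj y] side_other[OF assms(1-3)] assms(4,6)
  by (auto simp: doubleton_eq_iff)

lemma side_disjoint:
  assumes g: "simple_graph adj" and xy: "adj x y" "\<not> cyc_edge adj x y"
  shows "side adj x y \<inter> side adj y x = {}"
proof (rule ccontr)
  assume "side adj x y \<inter> side adj y x \<noteq> {}"
  then obtain z where "(del adj x y)\<^sup>*\<^sup>* x z" "(del adj x y)\<^sup>*\<^sup>* y z"
    by (auto simp: side_def del_commute[of adj y x])
  then have "(del adj x y)\<^sup>*\<^sup>* x y"
    using rtranclp_sym[OF simple_graph_del[OF g]] by (meson rtranclp_trans)
  then show False using xy cyc_edge_iff[OF g] by blast
qed

lemma cyc_edge_commute: "cyc_edge adj u v = cyc_edge adj v u"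
  by (simp add: cyc_edge_def insert_commute)

text \<open>An inner bridge has an end that it separates from \<open>x\<close>. The side of that end
  avoids \<open>x\<close>, hence cannot cross the edge \<open>xy\<close>, and is strictly
  smaller.\<close>

lemma side_nested:
  assumes g: "simple_graph adj" and xy: "adj x y" "\<not> cyc_edge adj x y"
    and ab: "a \<in> side adj x y" "b \<in> side adj x y" "adj a b" "\<not> cyc_edge adj a b"
  shows "side adj b a \<subset> side adj x y \<or> side adj a b \<subset> side adj x y"
proof -
  let ?D = "del adj x y"
  have key: "side adj b a \<subset> side adj x y"
    if ab: "b \<in> side adj x y" "\<not> (del ?D a b)\<^sup>*\<^sup>* x b" for a b
  proof -
    have sym: "(del ?D a b)\<^sup>*\<^sup>* u v \<Longrightarrow> (del ?D a b)\<^sup>*\<^sup>* v u" for u v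
      by (rule rtranclp_sym[OF simple_graph_del[OF simple_graph_del[OF g]]])
    have *: "(del ?D a b)\<^sup>*\<^sup>* b z \<Longrightarrow> z \<in> side adj x y" for z
    proof -
      assume "(del ?D a b)\<^sup>*\<^sup>* b z"
      then have "?D\<^sup>*\<^sup>* b z" by (rule predicate2D[OF rtranclp_mono[OF del_le]])
      then show ?thesis using ab(1) unfolding side_def by (auto intro: rtranclp_trans)
    qed
    \<comment> \<open>A walk from \<open>b\<close> that avoids \<open>ab\<close> reaches neither
      \<open>x\<close>, by assumption, nor \<open>y\<close>, which is outside the side; so it avoids
      \<open>xy\<close> too.\<close>
    have **: "(del ?D a b)\<^sup>*\<^sup>* b z" if "(del adj a b)\<^sup>*\<^sup>* b z" for z
      using that
    proof (induction rule: rtranclp_induct)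
      case (step z w)
      have "z \<noteq> x" using step.IH sym ab(2) by blast
      moreover have "z \<noteq> y" using *[OF step.IH] side_other[OF g xy] by blast
      ultimately have "del ?D a b z w" using step.hyps(2) by (auto simp: del_def doubleton_eq_iff)
      then show ?case using step.IH by (meson rtranclp.rtrancl_into_rtrancl)
    qed simp
    have "side adj b a \<subseteq> side adj x y" using * ** by (auto simp: side_def del_commute[of adj b a])
    moreover have "x \<notin> side adj b a" using ** sym ab(2) by (auto simp: side_def del_commute[of adj b a])
    ultimately show ?thesis using side_self[of x adj y] by blast
  qed
  show ?thesis
  proof (cases "(del ?D a b)\<^sup>*\<^sup>* x b")
    case False then show ?thesis using key[OF ab(2)] by blast
  next
    case True
    have "\<not> (del ?D a b)\<^sup>*\<^sup>* x a"
    proof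
      assume "(del ?D a b)\<^sup>*\<^sup>* x a"
      then have "(del ?D a b)\<^sup>*\<^sup>* a b"
        using True rtranclp_sym[OF simple_graph_del[OF simple_graph_del[OF g]]] by (meson rtranclp_trans)
      moreover have "del ?D a b \<le> del adj a b" by (auto simp: del_def)
      ultimately have "(del adj a b)\<^sup>*\<^sup>* a b" by (metis predicate2D rtranclp_mono)
      then show False using ab(3,4) cyc_edge_iff[OF g] by blast
    qed
    then show ?thesis using key[OF ab(1)] by (metis del_commute)
  qed
qed

lemma end_exists:
  fixes adj :: "'n::finite \<Rightarrow> 'n \<Rightarrow> bool"
  assumes g: "simple_graph adj" and xy: "adj x y" "\<not> cyc_edge adj x y"
  shows "\<exists>x' y'. adj x' y' \<and> \<not> cyc_edge adj x' y' \<and> side adj x' y' \<subseteq> side adj x y \<and>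
    (\<forall>a\<in>side adj x' y'. \<forall>b\<in>side adj x' y'. adj a b \<longrightarrow> cyc_edge adj a b)"
  using xy
proof (induction "card (side adj x y)" arbitrary: x y rule: less_induct)
  case less
  show ?case
  proof (cases "\<forall>a\<in>side adj x y. \<forall>b\<in>side adj x y. adj a b \<longrightarrow> cyc_edge adj a b")
    case True then show ?thesis using less.prems by blast
  next
    case False
    then obtain a b where ab: "a \<in> side adj x y" "b \<in> side adj x y" "adj a b" "\<not> cyc_edge adj a b"
      by blast
    then obtain p q where "adj p q" "\<not> cyc_edge adj p q" "side adj p q \<subset> side adj x y"
      using side_nested[OF g less.prems ab] simple_graph_sym[OF g] cyc_edge_commute by metis
    moreover from this have "card (side adj p q) < card (side adj x y)"
      by (simp add: psubset_card_mono)
    ultimately show ?thesis using less.hyps[of p q] by blast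
  qed
qed

lemma cycles_disjoint_edge:
  assumes "cycles_disjoint adj" "is_cycle adj c1" "is_cycle adj c2" "x \<in> set c1" "x \<in> set c2"
  shows "cycle_edges c1 = cycle_edges c2" "set c1 = set c2"
  using assms unfolding cycles_disjoint_def set_cycle_edges by blast+

text \<open>If \<open>x\<close> has a further neighbour, the edge to it lies on a cycle, which
  cannot use the bridge and so stays in the side. Every other edge of the side lies on a cycle as
  well; moving out from the first cycle, disjointness identifies them all with it.\<close>

lemma end_structure:
  assumes g: "simple_graph adj" and d: "cycles_disjoint adj"
    and xy: "adj x y" "\<not> cyc_edge adj x y"
    and inner: "\<forall>a\<in>side adj x y. \<forall>b\<in>side adj x y. adj a b \<longrightarrow> cyc_edge adj a b"
  shows "side adj x y = {x} \<or> (\<exists>cs. is_cycle adj cs \<and> set cs = side adj x y)"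
proof (cases "side adj x y = {x}")
  case False
  have "\<exists>z. del adj x y x z"
  proof (rule ccontr)
    assume "\<not> ?thesis"
    then have "side adj x y = {x}" unfolding side_def by (auto elim: converse_rtranclpE)
    then show False using False by simp
  qed
  then obtain z where z: "adj x z" "{x, z} \<noteq> {x, y}" by (auto simp: del_def)
  then have "z \<in> side adj x y" using side_step side_self by metis
  then obtain cs where cs: "is_cycle adj cs" "{x, z} \<in> cycle_edges cs"
    using inner z side_self by (metis cyc_edge_def)
  have "set cs \<subseteq> side adj x y"
  proof (rule cycle_closed[OF cs(1)])
    fix a b assume ab: "a \<in> side adj x y" "{a, b} \<in> cycle_edges cs"
    then have "adj a b" "{a, b} \<noteq> {x, y}"
      using cycle_edges_D[OF cs(1) g] xy(2) cs(1) by (auto simp: cyc_edge_def)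
    then show "b \<in> side adj x y" using side_step ab by metis
  qed (use cycle_edges_D[OF cs(1) g cs(2)] side_self in auto)
  moreover have "side adj x y \<subseteq> set cs"
  proof
    fix w assume "w \<in> side adj x y"
    then have "(del adj x y)\<^sup>*\<^sup>* x w" by (simp add: side_def)
    then show "w \<in> set cs"
    proof (induction rule: rtranclp_induct)
      case base show ?case using cycle_edges_D[OF cs(1) g cs(2)] by simp
    next
      case (step u v)
      have "u \<in> side adj x y" "v \<in> side adj x y"
        using step.hyps by (auto simp: side_def intro: rtranclp.rtrancl_into_rtrancl)
      then have "cyc_edge adj u v" using inner step.hyps(2) by (auto simp: del_def)
      then obtain c2 where c2: "is_cycle adj c2" "{u, v} \<in> cycle_edges c2" by (auto simp: cyc_edge_def)
      then have "u \<in> set c2" "v \<in> set c2" using cycle_edges_D[OF c2(1) g c2(2)] by auto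
      then show ?case using cycles_disjoint_edge(2)[OF d cs(1) c2(1)] step.IH by auto
    qed
  qed
  ultimately show ?thesis using cs(1) by blast
qed simp

text \<open>After deletion of a chord its ends remain connected along the cycle.\<close>

lemma chord_cyc_edge:
  assumes g: "simple_graph adj" and cs: "is_cycle adj cs" "u \<in> set cs" "v \<in> set cs" and uv: "adj u v"
  shows "cyc_edge adj u v"
proof (cases "{u, v} \<in> cycle_edges cs")
  case True then show ?thesis using cs by (auto simp: cyc_edge_def)
next
  case False
  then have c: "is_cycle (del adj u v) cs" using is_cycle_del cs by metis
  have "set cs \<subseteq> {w. (del adj u v)\<^sup>*\<^sup>* u w}"
    using cs(2) by (intro cycle_closed[OF c])
      (auto dest: cycle_edges_D(1)[OF c simple_graph_del[OF g]] intro: rtranclp.rtrancl_into_rtrancl)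
  then have "(del adj u v)\<^sup>*\<^sup>* u v" using cs(3) by blast
  then show ?thesis using cyc_edge_iff[OF g uv] by simp
qed

subsection \<open>Vertex covers\<close>

text \<open>The independence number enters only through \<open>\<alpha> = n - \<tau>\<close>, with \<open>\<tau>\<close> the vertex cover number, because \<open>\<tau>\<close> is
  insensitive to isolated vertices.\<close>

definition cover :: "('n \<Rightarrow> 'n \<Rightarrow> bool) \<Rightarrow> 'n set \<Rightarrow> bool" where
  "cover adj S \<longleftrightarrow> (\<forall>u v. adj u v \<longrightarrow> u \<in> S \<or> v \<in> S)"

definition tau :: "('n \<Rightarrow> 'n \<Rightarrow> bool) \<Rightarrow> nat" where
  "tau adj = (LEAST k. \<exists>S. cover adj S \<and> card S = k)"

lemma tau_le: "cover adj S \<Longrightarrow> tau adj \<le> card S"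
  unfolding tau_def by (rule Least_le) blast

lemma tau_obtain:
  obtains S where "cover adj S" "card S = tau adj"
proof -
  have "\<exists>k S. cover adj S \<and> card S = k" by (auto simp: cover_def)
  from LeastI_ex[OF this] show ?thesis using that by (auto simp: tau_def)
qed

lemma tau_le_cover_restr:
  fixes adj :: "'n::finite \<Rightarrow> 'n \<Rightarrow> bool"
  shows "tau adj \<le> tau (restr adj (- K)) + card K"
proof -
  obtain S where S: "cover (restr adj (- K)) S" "card S = tau (restr adj (- K))" using tau_obtain .
  have "cover adj (S \<union> K)" using S(1) by (auto simp: cover_def restr_def)
  then have "tau adj \<le> card (S \<union> K)" by (rule tau_le)
  also have "\<dots> \<le> card S + card K" by (rule card_Un_le)
  finally show ?thesis using S(2) by simp
qed

lemma tau_superadd: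
  fixes g :: "'n::finite \<Rightarrow> 'n \<Rightarrow> bool"
  assumes "a \<le> g" "b \<le> g" "\<And>u v. a u v \<Longrightarrow> u \<in> W \<and> v \<in> W" "\<And>u v. b u v \<Longrightarrow> u \<notin> W \<and> v \<notin> W"
  shows "tau a + tau b \<le> tau g"
proof -
  obtain S where S: "cover g S" "card S = tau g" using tau_obtain .
  have "cover a (S \<inter> W)" "cover b (S - W)" using S(1) assms by (fastforce simp: cover_def)+
  then have "tau a + tau b \<le> card (S \<inter> W) + card (S - W)" using tau_le add_mono by blast
  also have "\<dots> = card S"
    by (subst card_Un_disjoint[symmetric]) (auto simp: Int_Diff_Un intro: arg_cong[where f = card])
  finally show ?thesis using S(2) by simp
qed

lemma tau_pendant:
  fixes adj :: "'n::finite \<Rightarrow> 'n \<Rightarrow> bool"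
  assumes g: "simple_graph adj" and xy: "adj x y" and pend: "\<And>b. adj x b \<Longrightarrow> b = y"
  shows "tau (restr adj (- {y})) + 1 \<le> tau adj"
proof -
  obtain S where S: "cover adj S" "card S = tau adj" using tau_obtain .
  have pend': "b = y" if "adj b x" for b using pend simple_graph_sym[OF g that] .
  have "\<exists>z\<in>S. cover (restr adj (- {y})) (S - {z})"
  proof (cases "y \<in> S")
    case True
    then show ?thesis using S(1) by (intro bexI[of _ y]) (auto simp: cover_def restr_def)
  next
    case False
    then have "x \<in> S" using S(1) xy by (auto simp: cover_def)
    then show ?thesis using S(1) pend pend' by (intro bexI[of _ x]) (auto simp: cover_def restr_def)
  qed
  then obtain z where z: "z \<in> S" "cover (restr adj (- {y})) (S - {z})" by blast
  have "card S = Suc (card (S - {z}))" using z(1) by (metis card_Suc_Diff1 finite)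
  then show ?thesis using tau_le[OF z(2)] S(2) by simp
qed

lemma tau_empty: "(\<And>u v. \<not> adj u v) \<Longrightarrow> tau adj = 0"
  using tau_le[of adj "{}"] by (auto simp: cover_def)

lemma indep_num_card_le:
  assumes "finite V" "S \<subseteq> V" "\<And>x y. x \<in> S \<Longrightarrow> y \<in> S \<Longrightarrow> \<not> adj x y"
  shows "card S \<le> indep_num V adj"
proof -
  have "finite {card S | S. S \<subseteq> V \<and> (\<forall>x\<in>S. \<forall>y\<in>S. \<not> adj x y)}"
    by (rule finite_subset[of _ "card ` Pow V"]) (use assms in auto)
  then show ?thesis unfolding indep_num_def using assms by (intro Max_ge) auto
qed

lemma indep_num_obtain:
  assumes "finite V"
  obtains S where "S \<subseteq> V" "\<And>x y. x \<in> S \<Longrightarrow> y \<in> S \<Longrightarrow> \<not> adj x y" "card S = indep_num V adj"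
proof -
  let ?A = "{card S | S. S \<subseteq> V \<and> (\<forall>x\<in>S. \<forall>y\<in>S. \<not> adj x y)}"
  have "finite ?A" by (rule finite_subset[of _ "card ` Pow V"]) (use assms in auto)
  moreover have "card {} \<in> ?A" by (rule CollectI, rule exI[of _ "{}"]) simp
  ultimately have "Max ?A \<in> ?A" using Max_in by blast
  then show ?thesis using that unfolding indep_num_def by auto
qed

lemma indep_num_UNIV:
  fixes adj :: "'n::finite \<Rightarrow> 'n \<Rightarrow> bool"
  shows "indep_num UNIV adj + tau adj = CARD('n)"
proof -
  obtain S where S: "cover adj S" "card S = tau adj" using tau_obtain .
  have "card (- S) \<le> indep_num UNIV adj"
    using S(1) by (intro indep_num_card_le) (auto simp: cover_def)
  moreover obtain I where I: "\<And>x y. x \<in> I \<Longrightarrow> y \<in> I \<Longrightarrow> \<not> adj x y" "card I = indep_num UNIV adj"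
    using indep_num_obtain[of UNIV adj] by auto
  have "tau adj \<le> card (- I)" using I(1) by (intro tau_le) (auto simp: cover_def)
  ultimately show ?thesis
    using I(2) S(2) card_mono[of UNIV S] card_mono[of UNIV I] by (simp add: Compl_eq_Diff_UNIV card_Diff_subset)
qed

text \<open>Double counting: each of the l cycle edges needs a vertex of the cover, and each vertex
  meets only two of them. Chords can only increase the cover number.\<close>

lemma tau_cycle_ge:
  fixes adj :: "'n::finite \<Rightarrow> 'n \<Rightarrow> bool"
  assumes cs: "is_cycle adj cs"
  shows "(length cs + 1) div 2 \<le> tau (restr adj (set cs))"
proof -
  obtain S where S: "cover (restr adj (set cs)) S" "card S = tau (restr adj (set cs))" using tau_obtain .
  define f where "f i = (if cs ! i \<in> S then 1 else 0 :: nat)" for i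
  have c: "is_cycle (restr adj (set cs)) cs" using cs by (simp add: is_cycle_restr_iff)
  have l: "length cs \<ge> 3" "distinct cs" using cs by (auto simp: is_cycle_def)
  have "1 \<le> f i + f ((i + 1) mod length cs)" if "i < length cs" for i
    using c S(1) that unfolding is_cycle_def cover_def f_def by auto
  then have "(\<Sum>i<length cs. 1) \<le> (\<Sum>i<length cs. f i + f ((i + 1) mod length cs))"
    by (intro sum_mono) auto
  also have "\<dots> = (\<Sum>i<length cs. f i) + (\<Sum>i<length cs. f ((i + 1) mod length cs))"
    by (rule sum.distrib)
  also have "(\<Sum>i<length cs. f ((i + 1) mod length cs)) = (\<Sum>i<length cs. f i)"
  proof -
    obtain m where m: "length cs = Suc m" using l by (cases "length cs") auto
    have "(\<Sum>i<Suc m. f ((i + 1) mod Suc m)) = (\<Sum>i<m. f (Suc i)) + f 0" by simp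
    also have "\<dots> = (\<Sum>i<Suc m. f i)" by (subst sum.lessThan_Suc_shift) simp
    finally show ?thesis by (simp only: m)
  qed
  also have "(\<Sum>i<length cs. f i) = card {i\<in>{..<length cs}. cs ! i \<in> S}"
    by (simp add: f_def sum.If_cases Int_def)
  also have "\<dots> \<le> card S"
    using l by (intro card_inj_on_le[where f = "nth cs"]) (auto simp: inj_on_def nth_eq_iff_index_eq)
  finally have "length cs \<le> 2 * card S" by simp
  then have "(length cs + 1) div 2 \<le> card S" by presburger
  then show ?thesis using S(2) by simp
qed

text \<open>The cover can be made to contain a prescribed \<open>x\<close>. This matters twice: it
  then covers a bridge at \<open>x\<close> for free, and it shrinks by one when \<open>x\<close> is
  deleted.\<close>

lemma cycle_cover:
  fixes adj :: "'n::finite \<Rightarrow> 'n \<Rightarrow> bool"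
  assumes cs: "is_cycle adj cs" and x: "x \<in> set cs"
    and inner: "\<And>u v. u \<in> set cs \<Longrightarrow> v \<in> set cs \<Longrightarrow> adj u v \<Longrightarrow> {u, v} \<in> cycle_edges cs"
  obtains S where "x \<in> S" "card S \<le> (length cs + 1) div 2" "cover (restr adj (set cs)) S"
proof -
  obtain c where c: "is_cycle adj c" "c ! 0 = x" "set c = set cs" "cycle_edges c = cycle_edges cs"
    "length c = length cs" using cycle_start_at[OF cs x] .
  \<comment> \<open>The even positions counted from \<open>x\<close>. For odd length the last
    position is even too, so both ends of the closing edge are chosen, which explains the rounding
    up.\<close>
  let ?S = "(\<lambda>k. c ! (2 * k)) ` {..<(length cs + 1) div 2}"
  have l: "length cs \<ge> 3" using cs by (simp add: is_cycle_def)
  have even_in: "c ! i \<in> ?S" if "i < length cs" "even i" for i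
    using that by (intro image_eqI[of _ _ "i div 2"]) auto
  have "c ! 0 \<in> ?S" by (rule even_in) (use l in auto)
  then have "x \<in> ?S" using c(2) by simp
  moreover have "card ?S \<le> (length cs + 1) div 2"
    using card_image_le[of "{..<(length cs + 1) div 2}" "\<lambda>k. c ! (2 * k)"] by simp
  moreover have "cover (restr adj (set cs)) ?S"
    unfolding cover_def
  proof (intro allI impI)
    fix u v assume "restr adj (set cs) u v"
    then have "{u, v} \<in> cycle_edges c" using inner c(4) by (auto simp: restr_def)
    then obtain i where i: "i < length cs" "{u, v} = {c ! i, c ! ((i + 1) mod length cs)}"
      using c(5) by (auto simp: cycle_edges_def)
    have "c ! i \<in> ?S \<or> c ! ((i + 1) mod length cs) \<in> ?S"
    proof (cases "even i")
      case True then show ?thesis using even_in[of i] i by auto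
    next
      case False
      show ?thesis
      proof (cases "i + 1 = length cs")
        case True then show ?thesis using \<open>c ! 0 \<in> ?S\<close> by simp
      next
        case ne: False
        then have "c ! (i + 1) \<in> ?S" using even_in[of "i + 1"] i(1) False by auto
        then show ?thesis using ne i(1) by simp
      qed
    qed
    then show "u \<in> ?S \<or> v \<in> ?S" using i(2) by (metis doubleton_eq_iff)
  qed
  ultimately show ?thesis by (rule that)
qed

subsection \<open>Gain matrices\<close>

abbreviation (input) "M \<equiv> gain_adj_matrix"

lemma unit_gain_mono: "unit_gain g \<phi> \<Longrightarrow> h \<le> g \<Longrightarrow> unit_gain h \<phi>"
  unfolding unit_gain_def by auto

lemma gain_matrix_restr: "M (restr adj W) \<phi> = proj W ** M adj \<phi> ** proj W"
  by (auto simp: gain_adj_matrix_def proj_mult_left proj_mult_right restr_def vec_eq_iff)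

lemma rank_restr_le: "rank (M (restr adj W) \<phi>) \<le> rank (M adj \<phi>)"
  unfolding gain_matrix_restr by (rule order_trans[OF rank_mult_le_left rank_mult_le_right])

lemma rank_restr_ge: "rank (M adj \<phi>) \<le> rank (M (restr adj (- K)) \<phi>) + 2 * card K"
proof -
  have "finite K" by simp
  then show ?thesis
  proof (induction K rule: finite_induct)
    case empty
    have "restr adj (- {}) = adj" by (auto simp: restr_def fun_eq_iff)
    then show ?case by simp
  next
    case (insert x K)
    have "restr (restr adj (- K)) (- {x}) = restr adj (- insert x K)"
      by (auto simp: restr_def fun_eq_iff)
    then have "rank (M (restr adj (- K)) \<phi>) \<le> rank (M (restr adj (- insert x K)) \<phi>) + 2"
      using rank_delete_ge[of "M (restr adj (- K)) \<phi>" x] by (metis gain_matrix_restr)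
    then show ?case using insert by simp
  qed
qed

lemma gain_matrix_empty: "(\<And>u v. \<not> adj u v) \<Longrightarrow> M adj \<phi> = 0"
  by (auto simp: gain_adj_matrix_def vec_eq_iff)

lemma rank_le_cover: "rank (M adj \<phi>) \<le> 2 * card S" if "cover adj S"
proof -
  have "M (restr adj (- S)) \<phi> = 0"
    using that by (intro gain_matrix_empty) (auto simp: restr_def cover_def)
  then show ?thesis using rank_restr_ge[of adj \<phi> S] by simp
qed

definition cnjv :: "complex^'n \<Rightarrow> complex^'n" where "cnjv w = (\<chi> i. cnj (w $ i))"

text \<open>The gain matrix is Hermitian, so conjugation turns every statement about
  \<open>w\<close> on the right into the one about the transpose that the two-sided deletion lemmas
  require.\<close>

lemma transpose_gain_matrix:
  assumes "simple_graph adj" "unit_gain adj \<phi>"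
  shows "transpose (M adj \<phi>) *v cnjv w = cnjv (M adj \<phi> *v w)"
proof -
  have "transpose (M adj \<phi>) $ i $ j = cnj (M adj \<phi> $ i $ j)" for i j
  proof (cases "adj i j")
    case True
    then have "adj j i" "\<phi> j i = cnj (\<phi> i j)"
      using assms unfolding unit_gain_def simple_graph_def by blast+
    then show ?thesis using True by (simp add: transpose_def gain_adj_matrix_def)
  next
    case False
    then have "\<not> adj j i" using simple_graph_sym[OF assms(1)] by blast
    then show ?thesis using False by (simp add: transpose_def gain_adj_matrix_def)
  qed
  then show ?thesis
    by (simp add: vec_eq_iff cnjv_def matrix_vector_mult_def)
qed

lemma rank_gain_delete_drop2:
  assumes "simple_graph adj" "unit_gain adj \<phi>"
    and w: "M adj \<phi> *v w = c *s axis y 1" "c \<noteq> 0" "w $ y = 0"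
  shows "rank (M (restr adj (- {y})) \<phi>) + 2 \<le> rank (M adj \<phi>)"
proof -
  have "transpose (M adj \<phi>) *v cnjv w = cnj c *s axis y 1"
    unfolding transpose_gain_matrix[OF assms(1,2)] w(1) by (auto simp: cnjv_def vec_eq_iff axis_def)
  then show ?thesis unfolding gain_matrix_restr
    using rank_delete_drop2[OF w] w(2) by simp
qed

lemma rank_gain_delete_eq:
  assumes "simple_graph adj" "unit_gain adj \<phi>" and w: "M adj \<phi> *v w = 0" "w $ x \<noteq> 0"
  shows "rank (M (restr adj (- {x})) \<phi>) = rank (M adj \<phi>)"
proof -
  have "transpose (M adj \<phi>) *v cnjv w = 0"
    unfolding transpose_gain_matrix[OF assms(1,2)] w(1) by (simp add: cnjv_def vec_eq_iff)
  then show ?thesis unfolding gain_matrix_restr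
    using rank_eq_delete[OF w] w(2) by (simp add: cnjv_def)
qed

text \<open>Column \<open>x\<close> has its only nonzero entry at \<open>y\<close>, so the unit
  vector at \<open>x\<close> is the required witness.\<close>

lemma rank_pendant:
  assumes "simple_graph adj" "unit_gain adj \<phi>" and xy: "adj x y" and pend: "\<And>b. adj x b \<Longrightarrow> b = y"
  shows "rank (M (restr adj (- {y})) \<phi>) + 2 \<le> rank (M adj \<phi>)"
proof (rule rank_gain_delete_drop2[OF assms(1,2)])
  have nbr: "adj i x \<longleftrightarrow> i = y" for i using simple_graph_sym[OF assms(1)] xy pend by blast
  show "M adj \<phi> *v axis x 1 = \<phi> y x *s axis y 1"
    unfolding matrix_vector_mult_axis by (auto simp: vec_eq_iff column_def axis_def gain_adj_matrix_def nbr)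
  have "norm (\<phi> y x) = 1" using assms(2) nbr by (simp add: unit_gain_def)
  then show "\<phi> y x \<noteq> 0" by auto
  show "axis x 1 $ y = (0 :: complex)" using assms(1) xy by (auto simp: axis_def simple_graph_def)
qed

lemma rank_split_ge:
  assumes "simple_graph adj" "\<And>u v. adj u v \<Longrightarrow> u \<in> W \<Longrightarrow> v \<in> W"
  shows "rank (M (restr adj W) \<phi>) + rank (M (restr adj (- W)) \<phi>) \<le> rank (M adj \<phi>)"
  unfolding gain_matrix_restr
  using assms by (intro rank_block_le) (auto simp: gain_adj_matrix_def simple_graph_def)

lemma rank_split_le:
  assumes "simple_graph adj" "\<And>u v. adj u v \<Longrightarrow> u \<in> W \<Longrightarrow> v \<in> W"
  shows "rank (M adj \<phi>) \<le> rank (M (restr adj W) \<phi>) + rank (M (restr adj (- W)) \<phi>)"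
proof -
  have "M adj \<phi> = M (restr adj W) \<phi> + M (restr adj (- W)) \<phi>"
    using assms by (auto simp: gain_adj_matrix_def restr_def vec_eq_iff simple_graph_def)
  then show ?thesis using rank_add_le[of "M (restr adj W) \<phi>" "M (restr adj (- W)) \<phi>"] by simp
qed

section \<open>Kernel vectors of a single cycle\<close>

context
  fixes adj :: "'n::finite \<Rightarrow> 'n \<Rightarrow> bool" and \<phi> cs
  assumes g: "simple_graph adj" and u: "unit_gain adj \<phi>" and cs: "is_cycle adj cs"
begin

text \<open>Periodic indexing lets the recurrences run past the closing edge, and around the cycle
  twice, without case distinctions.\<close>

definition cyc_nth :: "nat \<Rightarrow> 'n" where "cyc_nth i = cs ! (i mod length cs)"

definition path_gain :: "nat \<Rightarrow> complex" where
  "path_gain i = (\<Prod>j<i. \<phi> (cyc_nth j) (cyc_nth (Suc j)))"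

lemma len_pos: "length cs \<ge> 3" "length cs > 0"
  using cs by (auto simp: is_cycle_def)

lemma cyc_nth_in: "cyc_nth i \<in> set cs"
  using len_pos by (simp add: cyc_nth_def)

lemma cyc_nth_adj: "adj (cyc_nth i) (cyc_nth (Suc i))"
proof -
  have "i mod length cs < length cs" using len_pos by simp
  then have "adj (cs ! (i mod length cs)) (cs ! ((i mod length cs + 1) mod length cs))"
    using cs unfolding is_cycle_def by blast
  then show ?thesis by (simp add: cyc_nth_def mod_simps)
qed

lemma cyc_nth_add_len: "cyc_nth (i + length cs) = cyc_nth i"
  by (simp add: cyc_nth_def)

lemma cyc_gain_norm: "norm (\<phi> (cyc_nth i) (cyc_nth (Suc i))) = 1"
  and cyc_gain_cnj: "\<phi> (cyc_nth (Suc i)) (cyc_nth i) = cnj (\<phi> (cyc_nth i) (cyc_nth (Suc i)))"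
  using u cyc_nth_adj unfolding unit_gain_def by blast+

lemma cnj_mult_norm1: "norm z = 1 \<Longrightarrow> z * cnj z = 1" for z :: complex
  by (simp add: complex_norm_square[symmetric])

lemma norm_path_gain: "norm (path_gain i) = 1"
  by (simp add: path_gain_def prod_norm[symmetric] cyc_gain_norm)

lemma path_gain_len: "path_gain (length cs) = cycle_gain \<phi> cs"
  by (auto simp: path_gain_def cycle_gain_def cyc_nth_def intro!: prod.cong)

lemma path_gain_Suc: "path_gain (Suc i) = path_gain i * \<phi> (cyc_nth i) (cyc_nth (Suc i))"
  by (simp add: path_gain_def)

lemma path_gain_add_len: "path_gain (i + length cs) = path_gain i * cycle_gain \<phi> cs"
proof (induction i)
  case (Suc i)
  then show ?case using cyc_nth_add_len[of i] cyc_nth_add_len[of "Suc i"] by (simp add: path_gain_Suc)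
qed (simp add: path_gain_len, simp add: path_gain_def)

text \<open>Row \<open>Suc k\<close> rather than row \<open>k\<close>, so that both neighbours have
  natural numbers as indices. The two summands are distinct because the length does not divide
  2.\<close>

lemma cycle_row:
  assumes inner: "\<And>u v. u \<in> set cs \<Longrightarrow> v \<in> set cs \<Longrightarrow> adj u v \<Longrightarrow> {u, v} \<in> cycle_edges cs"
  shows "(M (restr adj (set cs)) \<phi> *v w) $ cyc_nth (Suc k) =
    \<phi> (cyc_nth (Suc k)) (cyc_nth (Suc (Suc k))) * w $ cyc_nth (Suc (Suc k))
    + \<phi> (cyc_nth (Suc k)) (cyc_nth k) * w $ cyc_nth k"
proof -
  have inj: "cyc_nth i = cyc_nth j \<longleftrightarrow> i mod length cs = j mod length cs" for i j
    using cs len_pos unfolding cyc_nth_def is_cycle_def by (simp add: nth_eq_iff_index_eq)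
  have ne: "cyc_nth (Suc (Suc k)) \<noteq> cyc_nth k"
  proof
    assume "cyc_nth (Suc (Suc k)) = cyc_nth k"
    then have "length cs dvd 2" unfolding inj using mod_eq_dvd_iff_nat[of k "Suc (Suc k)" "length cs"] by auto
    then have "length cs \<le> 2" by (rule dvd_imp_le) simp
    then show False using len_pos by simp
  qed
  have nbrs: "restr adj (set cs) (cyc_nth (Suc k)) b \<longleftrightarrow> b = cyc_nth (Suc (Suc k)) \<or> b = cyc_nth k" for b
  proof
    assume "restr adj (set cs) (cyc_nth (Suc k)) b"
    then have "{cyc_nth (Suc k), b} \<in> cycle_edges cs" using inner by (auto simp: restr_def)
    then obtain i where i: "i < length cs" "{cyc_nth (Suc k), b} = {cyc_nth i, cyc_nth (Suc i)}"
      by (auto simp: cycle_edges_def cyc_nth_def)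
    consider "cyc_nth (Suc k) = cyc_nth i" "b = cyc_nth (Suc i)"
      | "cyc_nth (Suc k) = cyc_nth (Suc i)" "b = cyc_nth i"
      using i(2) by (auto simp: doubleton_eq_iff)
    then show "b = cyc_nth (Suc (Suc k)) \<or> b = cyc_nth k"
    proof cases
      case 1
      then have "cyc_nth (Suc (Suc k)) = cyc_nth (Suc i)" unfolding inj by (metis mod_Suc_eq)
      then show ?thesis using 1 by simp
    next
      case 2
      then have "(Suc k + (length cs - 1)) mod length cs = (Suc i + (length cs - 1)) mod length cs"
        unfolding inj by (metis mod_add_left_eq)
      then have "cyc_nth k = cyc_nth i" unfolding inj using len_pos by simp
      then show ?thesis using 2 by simp
    qed
  next
    assume "b = cyc_nth (Suc (Suc k)) \<or> b = cyc_nth k"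
    then show "restr adj (set cs) (cyc_nth (Suc k)) b"
      using cyc_nth_adj[of k] cyc_nth_adj[of "Suc k"] simple_graph_sym[OF g] cyc_nth_in by (auto simp: restr_def)
  qed
  have "(M (restr adj (set cs)) \<phi> *v w) $ cyc_nth (Suc k)
    = (\<Sum>b\<in>UNIV. if b \<in> {cyc_nth (Suc (Suc k)), cyc_nth k} then \<phi> (cyc_nth (Suc k)) b * w $ b else 0)"
    unfolding matrix_vector_mult_def gain_adj_matrix_def vec_lambda_beta nbrs by (intro sum.cong) auto
  also have "\<dots> = (\<Sum>b\<in>{cyc_nth (Suc (Suc k)), cyc_nth k}. \<phi> (cyc_nth (Suc k)) b * w $ b)"
    by (subst sum.inter_restrict[symmetric]) auto
  finally show ?thesis using ne by simp
qed

text \<open>With \<open>z\<^sub>i\<close> the entry at the \<open>i\<close>-th vertex multiplied by the gain of the walk to it, the kernel equations become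
  \<open>z\<^sub>i\<^sub>+\<^sub>2 = - z\<^sub>i\<close> and \<open>z\<^sub>i\<^sub>+\<^sub>l = \<phi>(C) z\<^sub>i\<close>; the sequence \<open>z\<^sub>i = r\<^sup>i\<close> solves them.\<close>

lemma cycle_null_vector:
  assumes inner: "\<And>u v. u \<in> set cs \<Longrightarrow> v \<in> set cs \<Longrightarrow> adj u v \<Longrightarrow> {u, v} \<in> cycle_edges cs"
    and lam: "r ^ 2 = -1" "r ^ length cs = cycle_gain \<phi> cs"
  shows "\<exists>w. M (restr adj (set cs)) \<phi> *v w = 0 \<and> (\<forall>x. w $ x \<noteq> 0 \<longleftrightarrow> x \<in> set cs)"
proof -
  \<comment> \<open>Here \<open>z i\<close> is the entry itself: gains have modulus 1, so the
    conjugate divides \<open>r ^ i\<close> by the gain of the walk.\<close>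
  define z where "z i = cnj (path_gain i) * r ^ i" for i
  have "norm (cycle_gain \<phi> cs) = 1" using norm_path_gain[of "length cs"] path_gain_len by simp
  then have "cycle_gain \<phi> cs * cnj (cycle_gain \<phi> cs) = 1" by (rule cnj_mult_norm1)
  then have per: "z (i + length cs) = z i" for i
    by (simp add: z_def path_gain_add_len power_add lam(2) mult_ac)
  have per': "z (i mod length cs) = z i" for i
  proof -
    have "z (j + length cs * k) = z j" for j k
      by (induction k) (simp_all add: per algebra_simps, metis per add.commute add.left_commute)
    from this[of "i mod length cs" "i div length cs"] show ?thesis by simp
  qed
  have "\<exists>i<length cs. cs ! i = x" if "x \<in> set cs" for x using that by (simp add: in_set_conv_nth)
  then obtain idx where idx: "\<And>x. x \<in> set cs \<Longrightarrow> idx x < length cs \<and> cs ! idx x = x" by metis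
  define w :: "complex^'n" where "w = (\<chi> x. if x \<in> set cs then z (idx x) else 0)"
  have wz: "w $ cyc_nth i = z i" for i
  proof -
    have "idx (cyc_nth i) = i mod length cs"
      using idx[OF cyc_nth_in[of i]] cs len_pos unfolding cyc_nth_def is_cycle_def
      by (metis mod_less_divisor nth_eq_iff_index_eq)
    then show ?thesis using cyc_nth_in per' by (simp add: w_def)
  qed
  have "(M (restr adj (set cs)) \<phi> *v w) $ x = 0" for x
  proof (cases "x \<in> set cs")
    case False
    then show ?thesis by (auto simp: matrix_vector_mult_def gain_adj_matrix_def restr_def)
  next
    case True
    \<comment> \<open>Adding the length makes the index a successor even for the first vertex, as
      \<open>cycle_row\<close> needs.\<close>
    then have "x = cyc_nth (idx x + length cs)" using idx[OF True] by (simp add: cyc_nth_def)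
    moreover obtain k where "idx x + length cs = Suc k" using len_pos by (cases "idx x + length cs") auto
    ultimately have x: "x = cyc_nth (Suc k)" by simp
    have a: "\<phi> (cyc_nth i) (cyc_nth (Suc i)) * cnj (path_gain (Suc i)) = cnj (path_gain i)" for i
      using cnj_mult_norm1[OF cyc_gain_norm[of i]] by (simp add: path_gain_Suc mult_ac)
    have "\<phi> (cyc_nth (Suc k)) (cyc_nth (Suc (Suc k))) * z (Suc (Suc k)) + \<phi> (cyc_nth (Suc k)) (cyc_nth k) * z k
      = (\<phi> (cyc_nth (Suc k)) (cyc_nth (Suc (Suc k))) * cnj (path_gain (Suc (Suc k)))) * r ^ Suc (Suc k)
        + cnj (path_gain (Suc k)) * r ^ k"
      by (simp add: z_def cyc_gain_cnj path_gain_Suc mult_ac)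
    also have "\<dots> = cnj (path_gain (Suc k)) * (r ^ k * (r ^ 2 + 1))"
      unfolding a by (simp add: algebra_simps power2_eq_square)
    also have "\<dots> = 0" by (simp add: lam)
    finally show ?thesis using cycle_row[OF inner, of w k] by (simp add: x wz)
  qed
  then have "M (restr adj (set cs)) \<phi> *v w = 0" by (simp add: vec_eq_iff)
  moreover have "r \<noteq> 0" using lam(1) by auto
  then have "z i \<noteq> 0" for i using norm_path_gain[of i] by (auto simp: z_def)
  ultimately show ?thesis by (intro exI[of _ w]) (auto simp: w_def)
qed

text \<open>The recurrence moves in steps of two. For even length one turn compares the entry at the
  start with itself and yields the gain; for odd length two turns are needed, and only the square of
  the gain is determined.\<close>

lemma cycle_gain_of_null_vector:
  assumes inner: "\<And>u v. u \<in> set cs \<Longrightarrow> v \<in> set cs \<Longrightarrow> adj u v \<Longrightarrow> {u, v} \<in> cycle_edges cs"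
    and w: "M (restr adj (set cs)) \<phi> *v w = 0" "w $ (cs ! 0) \<noteq> 0"
  shows "even (length cs) \<Longrightarrow> cycle_gain \<phi> cs = (-1) ^ (length cs div 2)"
    and "odd (length cs) \<Longrightarrow> (cycle_gain \<phi> cs)\<^sup>2 = -1"
proof -
  define z where "z i = path_gain i * w $ cyc_nth i" for i
  have step: "z (Suc (Suc k)) = - z k" for k
  proof -
    have "\<phi> (cyc_nth (Suc k)) (cyc_nth (Suc (Suc k))) * w $ cyc_nth (Suc (Suc k))
      + cnj (\<phi> (cyc_nth k) (cyc_nth (Suc k))) * w $ cyc_nth k = 0"
      using cycle_row[OF inner, of w k] w(1) by (simp add: cyc_gain_cnj)
    then have "path_gain (Suc k) * (\<phi> (cyc_nth (Suc k)) (cyc_nth (Suc (Suc k))) * w $ cyc_nth (Suc (Suc k))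
      + cnj (\<phi> (cyc_nth k) (cyc_nth (Suc k))) * w $ cyc_nth k) = 0" by simp
    then have "z (Suc (Suc k)) + path_gain k * (\<phi> (cyc_nth k) (cyc_nth (Suc k)) * cnj (\<phi> (cyc_nth k) (cyc_nth (Suc k)))) * w $ cyc_nth k = 0"
      by (simp add: z_def path_gain_Suc algebra_simps)
    then show ?thesis using cnj_mult_norm1[OF cyc_gain_norm[of k]] by (simp add: z_def eq_neg_iff_add_eq_0)
  qed
  have zm: "z (2 * m) = (-1) ^ m * z 0" for m by (induction m) (simp_all add: step)
  have zl: "z (i + length cs) = cycle_gain \<phi> cs * z i" for i
    by (simp add: z_def path_gain_add_len cyc_nth_add_len)
  have z0: "z 0 \<noteq> 0" using w(2) by (simp add: z_def path_gain_def cyc_nth_def)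
  show "cycle_gain \<phi> cs = (-1) ^ (length cs div 2)" if "even (length cs)"
    using zm[of "length cs div 2"] zl[of 0] that z0 by simp
  show "(cycle_gain \<phi> cs)\<^sup>2 = -1" if "odd (length cs)"
  proof -
    have "(cycle_gain \<phi> cs)\<^sup>2 * z 0 = z (length cs + length cs)"
      using zl[of 0] zl[of "length cs"] by (simp add: power2_eq_square)
    also have "\<dots> = - z 0" using zm[of "length cs"] that by (simp add: mult_2)
    finally have "((cycle_gain \<phi> cs)\<^sup>2 + 1) * z 0 = 0" by (simp add: algebra_simps)
    then show ?thesis using z0 by (simp add: eq_neg_iff_add_eq_0)
  qed
qed

lemma norm_cycle_gain: "norm (cycle_gain \<phi> cs) = 1"
  using norm_path_gain[of "length cs"] path_gain_len by simp

end

subsection \<open>The lower bound and its equality case\<close>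

lemma card_edges_restr_less:
  fixes adj :: "'n::finite \<Rightarrow> 'n \<Rightarrow> bool"
  assumes "simple_graph adj" "adj u v" "u \<notin> W"
  shows "card (edges (restr adj W)) < card (edges adj)"
  using assms by (intro card_edges_less[of _ _ u v] restr_le simple_graph_restr) (auto simp: restr_def)

lemma on_cycle_edge:
  assumes "simple_graph adj" "on_cycle adj x"
  obtains b where "adj x b"
  using assms cycle_edge_at cycle_edges_D(1) by (metis on_cycle_def)

lemma cyc_edge_on_cycle:
  assumes "simple_graph adj" "cyc_edge adj u v"
  shows "on_cycle adj u" "on_cycle adj v"
  using assms cycle_edges_D(2,3) by (metis on_cycle_def cyc_edge_def)+

lemma end_cases:
  fixes adj :: "'n::finite \<Rightarrow> 'n \<Rightarrow> bool"
  assumes g: "simple_graph adj" and d: "cycles_disjoint adj" and uv: "adj u v" "\<not> cyc_edge adj u v"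
  obtains x y where "adj x y" "\<not> cyc_edge adj x y" "side adj x y \<subseteq> side adj u v"
    "(\<forall>b. adj x b \<longrightarrow> b = y) \<or> (\<exists>cs. is_cycle adj cs \<and> set cs = side adj x y)"
proof -
  obtain x y where xy: "adj x y" "\<not> cyc_edge adj x y" "side adj x y \<subseteq> side adj u v"
    and inner: "\<forall>a\<in>side adj x y. \<forall>b\<in>side adj x y. adj a b \<longrightarrow> cyc_edge adj a b"
    using end_exists[OF g uv] by blast
  have "\<forall>b. adj x b \<longrightarrow> b = y" if "side adj x y = {x}"
  proof (intro allI impI)
    fix b assume b: "adj x b"
    then have "b \<notin> side adj x y" using that simple_graph_irrefl[OF g, of x] by auto
    then show "b = y" using side_leave[OF g xy(1,2) side_self b] by simp
  qed
  then show ?thesis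
    using that[OF xy] end_structure[OF g d xy(1,2) inner] by blast
qed

theorem rank_lower_bound:
  fixes adj :: "'n::finite \<Rightarrow> 'n \<Rightarrow> bool"
  assumes "simple_graph adj" "unit_gain adj \<phi>"
  shows "2 * int (tau adj) - 2 * cyclomatic adj \<le> int (rank (M adj \<phi>))"
  using assms
proof (induction "card (edges adj)" arbitrary: adj rule: less_induct)
  case less
  note g = less.prems(1)
  have IH: "2 * int (tau (restr adj (- {x}))) - 2 * cyclomatic (restr adj (- {x}))
      \<le> int (rank (M (restr adj (- {x})) \<phi>))" if "adj x b" for x b
    using less.prems that
    by (intro less.hyps card_edges_restr_less[of _ x b] simple_graph_restr unit_gain_mono[OF _ restr_le]) auto
  have tau: "tau adj \<le> tau (restr adj (- {x})) + 1" for x using tau_le_cover_restr[of adj "{x}"] by simp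
  consider (cycle) x where "on_cycle adj x" | (edge) u v where "\<And>x. \<not> on_cycle adj x" "adj u v"
    | (empty) "\<And>u v. \<not> adj u v" by blast
  then show ?case
  proof cases
    case cycle
    then obtain b where "adj x b" using on_cycle_edge[OF g] by blast
    from IH[OF this] show ?thesis
      using rank_restr_le[of adj "- {x}" \<phi>] tau[of x] cyclomatic_delete_on_cycle[OF g cycle] by linarith
  next
    case edge
    have nc: "\<not> is_cycle adj cs" for cs
      using edge(1)[of "cs ! 0"] cycle_hd_in[of adj cs] by (auto simp: on_cycle_def)
    \<comment> \<open>In a forest disjointness of cycles is vacuous and every edge is a bridge, so
      an end can only be a pendant vertex.\<close>
    then have "cycles_disjoint adj" "\<not> cyc_edge adj u v" by (auto simp: cycles_disjoint_def cyc_edge_def)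
    then obtain x y where xy: "adj x y" "\<And>b. adj x b \<Longrightarrow> b = y"
      using end_cases[OF g _ edge(2)] nc by metis
    have "cyclomatic (restr adj (- {y})) \<le> cyclomatic adj"
      by (intro cyclomatic_mono g simple_graph_restr restr_le)
    then show ?thesis
      using IH[OF simple_graph_sym[OF g xy(1)]] rank_pendant[OF less.prems xy] tau[of y] by linarith
  next
    case empty
    then show ?thesis using tau_empty[of adj] cyclomatic_empty[of adj] by simp
  qed
qed

section \<open>Graphs attaining the lower bound\<close>

definition optimal :: "('n::finite \<Rightarrow> 'n \<Rightarrow> bool) \<Rightarrow> ('n \<Rightarrow> 'n \<Rightarrow> complex) \<Rightarrow> bool" where
  "optimal adj \<phi> \<longleftrightarrow> int (rank (M adj \<phi>)) = 2 * int (tau adj) - 2 * cyclomatic adj"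

lemma lower_bound_restr:
  fixes adj :: "'n::finite \<Rightarrow> 'n \<Rightarrow> bool"
  assumes "simple_graph adj" "unit_gain adj \<phi>"
  shows "2 * int (tau (restr adj W)) - 2 * cyclomatic (restr adj W) \<le> int (rank (M (restr adj W) \<phi>))"
  using assms by (intro rank_lower_bound simple_graph_restr unit_gain_mono[OF _ restr_le])

text \<open>With primes for the smaller graph, 2 \<tau> - 2c \<le> 2 \<tau>' - 2c' \<le> r' \<le> r,
  so equality of the ends makes every step sharp.\<close>

lemma optimal_delete_on_cycle:
  assumes g: "simple_graph adj" and u: "unit_gain adj \<phi>" and o: "optimal adj \<phi>" and x: "on_cycle adj x"
  shows "optimal (restr adj (- {x})) \<phi>" "rank (M (restr adj (- {x})) \<phi>) = rank (M adj \<phi>)"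
    "cyclomatic (restr adj (- {x})) = cyclomatic adj - 1"
proof -
  have "tau adj \<le> tau (restr adj (- {x})) + 1" using tau_le_cover_restr[of adj "{x}"] by simp
  moreover note lower_bound_restr[OF g u, of "- {x}"] rank_restr_le[of adj "- {x}" \<phi>]
    cyclomatic_delete_on_cycle[OF g x]
  ultimately show "optimal (restr adj (- {x})) \<phi>" "rank (M (restr adj (- {x})) \<phi>) = rank (M adj \<phi>)"
    "cyclomatic (restr adj (- {x})) = cyclomatic adj - 1"
    using o unfolding optimal_def by linarith+
qed

text \<open>Now 2 \<tau>' - 2c' + 2 \<le> r' + 2 \<le> r = 2 \<tau> - 2c \<le> 2 \<tau>' + 2 - 2c',
  so all terms agree. In particular c' = c, which is impossible for a vertex on a cycle.\<close>

lemma optimal_delete_drop2: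
  assumes g: "simple_graph adj" and u: "unit_gain adj \<phi>" and o: "optimal adj \<phi>"
    and r: "rank (M (restr adj (- {y})) \<phi>) + 2 \<le> rank (M adj \<phi>)"
  shows "optimal (restr adj (- {y})) \<phi>" "\<not> on_cycle adj y" "tau adj = tau (restr adj (- {y})) + 1"
proof -
  have *: "tau adj \<le> tau (restr adj (- {y})) + 1" using tau_le_cover_restr[of adj "{y}"] by simp
  have c: "cyclomatic (restr adj (- {y})) \<le> cyclomatic adj"
    by (intro cyclomatic_mono g simple_graph_restr restr_le)
  note ** = * c lower_bound_restr[OF g u, of "- {y}"] r o[unfolded optimal_def]
  have "cyclomatic (restr adj (- {y})) = cyclomatic adj" using ** by linarith
  then show "\<not> on_cycle adj y" using cyclomatic_delete_on_cycle[OF g] by force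
  show "tau adj = tau (restr adj (- {y})) + 1" using ** by linarith
  show "optimal (restr adj (- {y})) \<phi>" unfolding optimal_def using ** by linarith
qed

text \<open>Both pieces obey the lower bound, and the three parameters combine in the direction that
  leaves no slack in either piece.\<close>

lemma optimal_split:
  assumes g: "simple_graph adj" and u: "unit_gain adj \<phi>" and o: "optimal adj \<phi>"
    and W: "\<And>u v. adj u v \<Longrightarrow> u \<in> W \<Longrightarrow> v \<in> W"
  shows "optimal (restr adj W) \<phi>"
proof -
  have "cyclomatic (restr adj W) + cyclomatic (restr adj (- W)) \<le> cyclomatic adj"
    using g by (intro cyclomatic_superadd simple_graph_restr restr_le) (auto simp: restr_def)
  moreover have "tau adj \<le> tau (restr adj W) + tau (restr adj (- W))"
  proof -
    obtain S where S: "cover (restr adj W) S" "card S = tau (restr adj W)" using tau_obtain .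
    obtain T where T: "cover (restr adj (- W)) T" "card T = tau (restr adj (- W))" using tau_obtain .
    have "cover adj (S \<union> T)"
      unfolding cover_def
    proof (intro allI impI)
      fix u v assume uv: "adj u v"
      then have "restr adj W u v \<or> restr adj (- W) u v"
        using W[OF uv] W[OF simple_graph_sym[OF g uv]] by (auto simp: restr_def)
      then show "u \<in> S \<union> T \<or> v \<in> S \<union> T" using S(1) T(1) by (auto simp: cover_def)
    qed
    then have "tau adj \<le> card (S \<union> T)" by (rule tau_le)
    then show ?thesis using card_Un_le[of S T] S(2) T(2) by simp
  qed
  moreover have "rank (M (restr adj W) \<phi>) + rank (M (restr adj (- W)) \<phi>) \<le> rank (M adj \<phi>)"
    by (rule rank_split_ge[OF g W])
  moreover note lower_bound_restr[OF g u, of W] lower_bound_restr[OF g u, of "- W"] o[unfolded optimal_def]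
  ultimately show ?thesis unfolding optimal_def by linarith
qed

lemma optimal_cycles_disjoint:
  assumes g: "simple_graph adj" and u: "unit_gain adj \<phi>" and o: "optimal adj \<phi>"
  shows "cycles_disjoint adj"
proof (rule ccontr)
  assume "\<not> ?thesis"
  from cyclomatic_delete_two_cycles[OF g this] obtain x where
    "on_cycle adj x" "cyclomatic (restr adj (- {x})) \<le> cyclomatic adj - 2" by blast
  then show False using optimal_delete_on_cycle(3)[OF g u o] by fastforce
qed

lemma cycle_inner:
  assumes g: "simple_graph adj" and d: "cycles_disjoint adj" and cs: "is_cycle adj cs"
    and uv: "u \<in> set cs" "v \<in> set cs" "adj u v"
  shows "{u, v} \<in> cycle_edges cs"
proof -
  obtain c where c: "is_cycle adj c" "{u, v} \<in> cycle_edges c"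
    using chord_cyc_edge[OF g cs uv] by (auto simp: cyc_edge_def)
  then have "u \<in> set c" using cycle_edges_D[OF c(1) g c(2)] by simp
  then show ?thesis using cycles_disjoint_edge(1)[OF d c(1) cs] uv(1) c(2) by blast
qed

section \<open>The gain condition and singular cycles\<close>

lemma Re_neg_one_power_mult_eq_0_iff:
  assumes "norm z = 1"
  shows "Re ((-1) ^ k * z) = 0 \<longleftrightarrow> z\<^sup>2 = -1"
proof -
  have "Re ((-1) ^ k * z) = 0 \<longleftrightarrow> Re z = 0" by (cases "even k") auto
  also have "\<dots> \<longleftrightarrow> z\<^sup>2 = -1"
  proof
    assume "Re z = 0"
    then have "(Im z)\<^sup>2 = 1" using assms cmod_power2[of z] by simp
    then show "z\<^sup>2 = -1" using \<open>Re z = 0\<close> by (simp add: complex_eq_iff power2_eq_square)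
  next
    assume "z\<^sup>2 = -1"
    then have "(z - \<i>) * (z + \<i>) = 0" by (simp add: algebra_simps power2_eq_square)
    then have "z = \<i> \<or> z = - \<i>" by (auto simp: eq_neg_iff_add_eq_0)
    then show "Re z = 0" by auto
  qed
  finally show ?thesis .
qed

lemma gain_condition_iff:
  fixes adj :: "'n::finite \<Rightarrow> 'n \<Rightarrow> bool"
  assumes "simple_graph adj" "unit_gain adj \<phi>"
  shows "gain_condition adj \<phi> \<longleftrightarrow> (\<forall>cs. is_cycle adj cs \<longrightarrow>
    (even (length cs) \<longrightarrow> cycle_gain \<phi> cs = (-1) ^ (length cs div 2)) \<and>
    (odd (length cs) \<longrightarrow> (cycle_gain \<phi> cs)\<^sup>2 = -1))"
  unfolding gain_condition_def Let_def
  using Re_neg_one_power_mult_eq_0_iff[OF norm_cycle_gain[OF assms]] by auto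

lemma singular_cycle_null_vector:
  assumes g: "simple_graph adj" and u: "unit_gain adj \<phi>" and d: "cycles_disjoint adj"
    and gc: "gain_condition adj \<phi>" and cs: "is_cycle adj cs"
  shows "\<exists>w. M (restr adj (set cs)) \<phi> *v w = 0 \<and> (\<forall>x. w $ x \<noteq> 0 \<longleftrightarrow> x \<in> set cs)"
proof -
  have "\<exists>r. r ^ 2 = -1 \<and> r ^ length cs = cycle_gain \<phi> cs"
  proof (cases "even (length cs)")
    case True
    then obtain m where m: "length cs = 2 * m" by blast
    then have "\<i> ^ length cs = cycle_gain \<phi> cs"
      using gc cs True unfolding gain_condition_iff[OF g u] by (auto simp: power_mult)
    then show ?thesis by (intro exI[of _ "\<i>"]) simp
  next
    case False
    then obtain m where m: "length cs = 2 * m + 1" using oddE by blast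
    have sq: "(cycle_gain \<phi> cs)\<^sup>2 = -1" using gc cs False unfolding gain_condition_iff[OF g u] by auto
    \<comment> \<open>Solving r^l = \<open>cycle_gain\<close> for l = 2m + 1 under r^2 = -1: the
      left side is (-1)^m * r, so r must be this.\<close>
    let ?r = "(-1) ^ m * cycle_gain \<phi> cs"
    have r2: "?r ^ 2 = -1" using sq by (simp add: power_mult_distrib flip: power_mult)
    have "?r ^ length cs = (?r ^ 2) ^ m * ?r" unfolding m by (simp only: power_add power_mult power_one_right)
    also have "\<dots> = cycle_gain \<phi> cs" unfolding r2 by (simp flip: mult.assoc power_mult_distrib)
    finally show ?thesis using r2 by blast
  qed
  then show ?thesis using cycle_null_vector[OF g u cs cycle_inner[OF g d cs]] by blast
qed

text \<open>Extended by zero, the kernel vector of the cycle is annihilated at all vertices but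
  \<open>y\<close>, since \<open>xy\<close> is the only edge leaving the cycle; there the entry is
  nonzero because the kernel vector vanishes nowhere on the cycle.\<close>

lemma rank_pendant_cycle:
  assumes g: "simple_graph adj" and u: "unit_gain adj \<phi>" and d: "cycles_disjoint adj"
    and gc: "gain_condition adj \<phi>" and cs: "is_cycle adj cs"
    and xy: "adj x y" "\<not> cyc_edge adj x y" and side: "set cs = side adj x y"
  shows "rank (M (restr adj (- {y})) \<phi>) + 2 \<le> rank (M adj \<phi>)"
proof -
  obtain w where w: "M (restr adj (set cs)) \<phi> *v w = 0" "\<And>x. w $ x \<noteq> 0 \<longleftrightarrow> x \<in> set cs"
    using singular_cycle_null_vector[OF g u d gc cs] by blast
  have y: "y \<notin> set cs" and x: "x \<in> set cs" using side_other[OF g xy] side_self side by auto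
  have leave: "a = x \<and> i = y" if "adj i a" "a \<in> set cs" "i \<notin> set cs" for a i
    using side_leave[OF g xy] simple_graph_sym[OF g that(1)] that(2,3) side by auto
  have "(M adj \<phi> *v w) $ i = ((\<phi> y x * w $ x) *s axis y 1) $ i" for i
  proof (cases "i \<in> set cs")
    case True
    have "(M adj \<phi> *v w) $ i = (M (restr adj (set cs)) \<phi> *v w) $ i"
      using True w(2) unfolding matrix_vector_mult_def gain_adj_matrix_def vec_lambda_beta restr_def
      by (intro sum.cong) auto
    then show ?thesis using w(1) True y by (auto simp: axis_def)
  next
    case False
    have "(M adj \<phi> *v w) $ i = (\<Sum>b\<in>UNIV. if b = x then if i = y then \<phi> y x * w $ x else 0 else 0)"
      unfolding matrix_vector_mult_def gain_adj_matrix_def vec_lambda_beta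
    proof (intro sum.cong refl)
      fix b
      show "(if adj i b then \<phi> i b else 0) * w $ b = (if b = x then if i = y then \<phi> y x * w $ x else 0 else 0)"
      proof (cases "b \<in> set cs \<and> adj i b")
        case True
        then show ?thesis using leave[of i b] False by simp
      next
        case nb: False
        have "\<not> (b = x \<and> i = y)" using nb x simple_graph_sym[OF g xy(1)] by blast
        moreover have "w $ b = 0 \<or> \<not> adj i b" using nb w(2)[of b] by blast
        ultimately show ?thesis by auto
      qed
    qed
    then show ?thesis by (simp add: axis_def)
  qed
  then have "M adj \<phi> *v w = (\<phi> y x * w $ x) *s axis y 1" by (simp add: vec_eq_iff)
  moreover have "norm (\<phi> y x) = 1" using u simple_graph_sym[OF g xy(1)] by (simp add: unit_gain_def)
  then have "\<phi> y x * w $ x \<noteq> 0" using w(2)[of x] x by auto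
  moreover have "w $ y = 0" using w(2)[of y] y by auto
  ultimately show ?thesis by (rule rank_gain_delete_drop2[OF g u])
qed

lemma gain_condition_restrD:
  fixes adj :: "'n::finite \<Rightarrow> 'n \<Rightarrow> bool"
  assumes "gain_condition (restr adj W) \<phi>" "is_cycle adj cs" "set cs \<subseteq> W" "simple_graph adj" "unit_gain adj \<phi>"
  shows "(even (length cs) \<longrightarrow> cycle_gain \<phi> cs = (-1) ^ (length cs div 2)) \<and>
    (odd (length cs) \<longrightarrow> (cycle_gain \<phi> cs)\<^sup>2 = -1)"
  using assms(1-3) unfolding gain_condition_iff[OF simple_graph_restr[OF assms(4)] unit_gain_mono[OF assms(5) restr_le]]
  by (simp add: is_cycle_restr_iff)

text \<open>Everything except the chosen cycle \<open>cs\<close> is stripped off by deletions that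
  keep equality and miss \<open>cs\<close>: a vertex of another cycle, or the neighbour of a pendant
  vertex.\<close>

lemma optimal_gain_condition:
  assumes "simple_graph adj" "unit_gain adj \<phi>" "optimal adj \<phi>"
  shows "gain_condition adj \<phi>"
  using assms
proof (induction "card (edges adj)" arbitrary: adj rule: less_induct)
  case less
  note g = less.prems(1) and u = less.prems(2) and o = less.prems(3)
  have d: "cycles_disjoint adj" by (rule optimal_cycles_disjoint[OF g u o])
  have IH: "gain_condition (restr adj (- {x})) \<phi>" if "optimal (restr adj (- {x})) \<phi>" "adj x b" for x b
    using g u that
    by (intro less.hyps card_edges_restr_less[of _ x b] simple_graph_restr unit_gain_mono[OF _ restr_le]) auto
  show ?case
    unfolding gain_condition_iff[OF g u]
  proof (intro allI impI)
    fix cs assume cs: "is_cycle adj cs"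
    consider (other) c where "is_cycle adj c" "cycle_edges c \<noteq> cycle_edges cs"
      | (bridge) u v where "\<And>c. is_cycle adj c \<Longrightarrow> cycle_edges c = cycle_edges cs" "adj u v" "\<not> cyc_edge adj u v"
      | (cycle) "\<And>c. is_cycle adj c \<Longrightarrow> cycle_edges c = cycle_edges cs" "\<And>u v. adj u v \<Longrightarrow> cyc_edge adj u v"
      by blast
    then show "(even (length cs) \<longrightarrow> cycle_gain \<phi> cs = (-1) ^ (length cs div 2)) \<and>
      (odd (length cs) \<longrightarrow> (cycle_gain \<phi> cs)\<^sup>2 = -1)"
    proof cases
      case other
      then have z: "on_cycle adj (c ! 0)" using cycle_hd_in by (auto simp: on_cycle_def)
      then obtain b where "adj (c ! 0) b" using on_cycle_edge[OF g] by blast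
      moreover have "c ! 0 \<notin> set cs"
        using d cs other cycle_hd_in[OF other(1)] unfolding cycles_disjoint_def by blast
      ultimately show ?thesis
        using IH optimal_delete_on_cycle(1)[OF g u o z] cs g u by (intro gain_condition_restrD[of adj "- {c ! 0}"]) auto
    next
      case bridge
      \<comment> \<open>Without a pendant vertex, both sides of the bridge would end in a cycle. The
        sides are disjoint, but only one cycle is left.\<close>
      have "\<exists>x y. adj x y \<and> (\<forall>b. adj x b \<longrightarrow> b = y)"
      proof (rule ccontr)
        assume neg: "\<not> ?thesis"
        have "\<exists>c. is_cycle adj c \<and> set c \<subseteq> side adj p q" if "adj p q" "\<not> cyc_edge adj p q" for p q
          using end_cases[OF g d that] neg by metis
        then obtain c1 c2 where c: "is_cycle adj c1" "set c1 \<subseteq> side adj u v" "is_cycle adj c2" "set c2 \<subseteq> side adj v u"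
          using bridge simple_graph_sym[OF g] cyc_edge_commute by metis
        then have "set c1 = set c2" using bridge(1) unfolding set_cycle_edges by metis
        then show False using c side_disjoint[OF g bridge(2,3)] cycle_hd_in[OF c(1)] by blast
      qed
      then obtain x y where xy: "adj x y" "\<And>b. adj x b \<Longrightarrow> b = y" by blast
      note D = optimal_delete_drop2[OF g u o rank_pendant[OF g u xy]]
      then have "y \<notin> set cs" using cs by (auto simp: on_cycle_def)
      then show ?thesis
        using IH[OF D(1) simple_graph_sym[OF g xy(1)]] cs g u by (intro gain_condition_restrD[of adj "- {y}"]) auto
    next
      case cycle
      have "restr adj (set cs) = adj"
      proof (intro ext iffI)
        fix a b assume ab: "adj a b"
        then obtain c where "is_cycle adj c" "{a, b} \<in> cycle_edges c" using cycle(2) by (auto simp: cyc_edge_def)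
        then have "{a, b} \<in> cycle_edges cs" using cycle(1) by auto
        then show "restr adj (set cs) a b" using cycle_edges_D[OF cs g] ab by (auto simp: restr_def)
      qed (simp add: restr_def)
      moreover have "on_cycle adj (cs ! 0)" using cs cycle_hd_in by (auto simp: on_cycle_def)
      \<comment> \<open>Deleting the first vertex of the cycle keeps the rank, hence some null
        vector is nonzero there.\<close>
      then have "rank (M adj \<phi>) \<le> rank (M (restr adj (- {cs ! 0})) \<phi>)"
        using optimal_delete_on_cycle(2)[OF g u o] by simp
      then obtain w where "M adj \<phi> *v w = 0" "w $ (cs ! 0) \<noteq> 0"
        using null_vector_if_rank_eq unfolding gain_matrix_restr by blast
      ultimately show ?thesis
        using cycle_gain_of_null_vector[OF g u cs cycle_inner[OF g d cs], of w] by simp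
    qed
  qed
qed

section \<open>Necessity of the cover condition\<close>

definition noncyc :: "('n \<Rightarrow> 'n \<Rightarrow> bool) \<Rightarrow> 'n set" where
  "noncyc adj = {v. \<not> on_cycle adj v}"

definition cyc_graph :: "('n \<Rightarrow> 'n \<Rightarrow> bool) \<Rightarrow> 'n \<Rightarrow> 'n \<Rightarrow> bool" where
  "cyc_graph adj u v \<longleftrightarrow> adj u v \<and> cyc_edge adj u v"

text \<open>Condition (iii) without the contracted graph: some minimum vertex cover of the forest induced by the non-cyclic
  vertices already covers every edge of the graph that lies on no cycle.\<close>

definition forest_cover :: "('n \<Rightarrow> 'n \<Rightarrow> bool) \<Rightarrow> bool" where
  "forest_cover adj \<longleftrightarrow> (\<exists>K \<subseteq> noncyc adj. card K \<le> tau (restr adj (noncyc adj)) \<and>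
     (\<forall>u v. adj u v \<longrightarrow> \<not> cyc_edge adj u v \<longrightarrow> u \<in> K \<or> v \<in> K))"

lemma tau_le_forest_cover:
  fixes adj :: "'n::finite \<Rightarrow> 'n \<Rightarrow> bool"
  assumes "\<And>u v. adj u v \<Longrightarrow> \<not> cyc_edge adj u v \<Longrightarrow> u \<in> K \<or> v \<in> K"
  shows "tau adj \<le> card K + tau (cyc_graph adj)"
proof -
  obtain S where S: "cover (cyc_graph adj) S" "card S = tau (cyc_graph adj)" using tau_obtain .
  have "cover adj (K \<union> S)" using S(1) assms unfolding cover_def cyc_graph_def by blast
  then have "tau adj \<le> card (K \<union> S)" by (rule tau_le)
  then show ?thesis using card_Un_le[of K S] S(2) by simp
qed

text \<open>The two graphs live on complementary vertex sets. The edges between the sets are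
  ignored; \<open>forest_cover\<close> says that they cost nothing extra.\<close>

lemma tau_forest_cyc_graph:
  fixes adj :: "'n::finite \<Rightarrow> 'n \<Rightarrow> bool"
  assumes g: "simple_graph adj"
  shows "tau (restr adj (noncyc adj)) + tau (cyc_graph adj) \<le> tau adj"
  using cyc_edge_on_cycle[OF g]
  by (intro tau_superadd[where W = "noncyc adj"] restr_le)
    (auto simp: restr_def cyc_graph_def noncyc_def)

lemma is_cycle_restr_off:
  assumes "\<And>x. x \<notin> W \<Longrightarrow> \<not> on_cycle adj x"
  shows "is_cycle (restr adj W) = is_cycle adj"
  using assms by (auto simp: fun_eq_iff is_cycle_restr_iff on_cycle_def)

lemma forest_cover_step:
  assumes sub: "noncyc H = noncyc adj" "\<And>u v. cyc_edge H u v \<longleftrightarrow> cyc_edge adj u v"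
    and y: "y \<in> noncyc adj" and H: "H = restr adj (- {y})"
    and tau: "tau (restr H (noncyc adj)) + 1 \<le> tau (restr adj (noncyc adj))"
    and fc: "forest_cover H"
  shows "forest_cover adj"
proof -
  obtain K where K: "K \<subseteq> noncyc adj" "card K \<le> tau (restr H (noncyc adj))"
    "\<And>u v. H u v \<Longrightarrow> \<not> cyc_edge adj u v \<Longrightarrow> u \<in> K \<or> v \<in> K"
    using fc unfolding forest_cover_def sub by blast
  show ?thesis
    unfolding forest_cover_def
  proof (intro exI[of _ "insert y K"] conjI allI impI)
    show "card (insert y K) \<le> tau (restr adj (noncyc adj))"
      using K(2) tau card_insert_le_m1[of "card K + 1" K y] by simp
    show "u \<in> insert y K \<or> v \<in> insert y K" if "adj u v" "\<not> cyc_edge adj u v" for u v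
      using K(3)[of u v] that by (auto simp: H restr_def)
  qed (use K(1) y in auto)
qed

lemma optimal_forest_cover:
  fixes adj :: "'n::finite \<Rightarrow> 'n \<Rightarrow> bool"
  assumes "simple_graph adj" "unit_gain adj \<phi>" "optimal adj \<phi>"
  shows "forest_cover adj"
  using assms
proof (induction "card (edges adj)" arbitrary: adj rule: less_induct)
  case less
  note g = less.prems(1) and u = less.prems(2) and o = less.prems(3)
  have d: "cycles_disjoint adj" by (rule optimal_cycles_disjoint[OF g u o])
  have gc: "gain_condition adj \<phi>" by (rule optimal_gain_condition[OF g u o])
  have IH: "forest_cover (restr adj W)" if "optimal (restr adj W) \<phi>" "adj x b" "x \<notin> W" for W x b
    using g u that
    by (intro less.hyps card_edges_restr_less[of _ x b] simple_graph_restr unit_gain_mono[OF _ restr_le]) auto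
  show ?case
  proof (cases "\<forall>u v. adj u v \<longrightarrow> cyc_edge adj u v")
    case True
    then show ?thesis unfolding forest_cover_def by (intro exI[of _ "{}"]) auto
  next
    case False
    then obtain x y where xy: "adj x y" "\<not> cyc_edge adj x y"
      and ends: "(\<forall>b. adj x b \<longrightarrow> b = y) \<or> (\<exists>cs. is_cycle adj cs \<and> set cs = side adj x y)"
      using end_cases[OF g d] by metis
    have yx: "adj y x" by (rule simple_graph_sym[OF g xy(1)])
    show ?thesis
    proof (cases "\<forall>b. adj x b \<longrightarrow> b = y")
      case True
      let ?H = "restr adj (- {y})"
      note D = optimal_delete_drop2[OF g u o rank_pendant[OF g u xy(1)]]
      have D: "optimal ?H \<phi>" "\<not> on_cycle adj y" using D True by blast+
      have same: "is_cycle ?H = is_cycle adj" using D(2) by (intro is_cycle_restr_off) auto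
      \<comment> \<open>The only neighbour \<open>y\<close> of \<open>x\<close> would lie on the
        same cycle, but \<open>y\<close> is on none.\<close>
      have "\<not> on_cycle adj x"
      proof
        assume "on_cycle adj x"
        then obtain cs b where "is_cycle adj cs" "x \<in> set cs" "{x, b} \<in> cycle_edges cs"
          using cycle_edge_at by (metis on_cycle_def)
        then have "adj x b" "b \<in> set cs" using cycle_edges_D[OF _ g] by blast+
        then show False using True D(2) \<open>is_cycle adj cs\<close> by (auto simp: on_cycle_def)
      qed
      then have Fxy: "restr adj (noncyc adj) x y" using xy(1) D(2) by (simp add: restr_def noncyc_def)
      have "tau (restr (restr adj (noncyc adj)) (- {y})) + 1 \<le> tau (restr adj (noncyc adj))"
      proof (rule tau_pendant[OF simple_graph_restr[OF g] Fxy])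
        fix b assume "restr adj (noncyc adj) x b"
        then have "adj x b" by (simp add: restr_def)
        then show "b = y" using True by blast
      qed
      moreover have "restr (restr adj (noncyc adj)) (- {y}) = restr ?H (noncyc adj)"
        by (simp add: restr_restr Int_commute)
      ultimately have tau: "tau (restr ?H (noncyc adj)) + 1 \<le> tau (restr adj (noncyc adj))" by simp
      have fc: "forest_cover ?H" using IH[OF D(1) yx] by simp
      have "noncyc ?H = noncyc adj" "cyc_edge ?H u v = cyc_edge adj u v" "y \<in> noncyc adj" for u v
        using D(2) by (simp_all add: noncyc_def on_cycle_def cyc_edge_def same)
      from forest_cover_step[OF this refl tau fc] show ?thesis .
    next
      case False
      \<comment> \<open>A pendant cycle attached at \<open>x\<close> to \<open>y\<close>: a cover of the forest is obtained from one for \<open>H2\<close> by adding \<open>y\<close>;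
        comparing the cover numbers of the optimal graphs \<open>H1\<close> and \<open>H2\<close> shows that it is minimum.\<close>
      then obtain cs where cs: "is_cycle adj cs" "set cs = side adj x y" using ends by blast
      let ?Y = "restr adj (- {y})"
      note D = optimal_delete_drop2[OF g u o rank_pendant_cycle[OF g u d gc cs(1) xy cs(2)]]
      have x: "x \<in> set cs" using side_self cs(2) by simp
      have y: "y \<notin> set cs" using D(2) cs(1) by (auto simp: on_cycle_def)
      have leave: "a = x \<and> b = y" if "adj a b" "a \<in> set cs" "b \<notin> set cs" for a b
        using side_leave[OF g xy _ that(1)] that cs(2) by auto
      have leave': "a = y \<and> b = x" if "adj a b" "a \<notin> set cs" "b \<in> set cs" for a b
        using leave[OF simple_graph_sym[OF g that(1)]] that by auto
      define H1 where "H1 = restr adj (- set cs)"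
      define H2 where "H2 = restr adj (- set cs - {y})"
      have H2: "H2 = restr H1 (- {y})" by (simp add: H1_def H2_def restr_restr Diff_eq)
      have on_x: "on_cycle adj x" using cs x by (auto simp: on_cycle_def)
      \<comment> \<open>Once \<open>x\<close> is deleted, the rest of the cycle is detached and can
        be split off; deleting \<open>y\<close> instead does the same for \<open>H2\<close>.\<close>
      have opt1: "optimal H1 \<phi>"
      proof -
        have "optimal (restr (restr adj (- {x})) (- set cs)) \<phi>"
        proof (rule optimal_split)
          show "b \<in> - set cs" if "restr adj (- {x}) a b" "a \<in> - set cs" for a b
            using that leave'[of a b] by (auto simp: restr_def)
        qed (use optimal_delete_on_cycle(1)[OF g u o on_x] g u in
            \<open>simp_all add: simple_graph_restr unit_gain_mono[OF _ restr_le]\<close>)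
        moreover have "- {x} \<inter> - set cs = - set cs" using x by blast
        ultimately show ?thesis by (simp add: H1_def restr_restr)
      qed
      have opt2: "optimal H2 \<phi>"
      proof -
        have "optimal (restr (restr adj (- {y})) (- set cs)) \<phi>"
        proof (rule optimal_split)
          show "b \<in> - set cs" if "restr adj (- {y}) a b" "a \<in> - set cs" for a b
            using that leave'[of a b] by (auto simp: restr_def)
        qed (use D(1) g u in \<open>simp_all add: simple_graph_restr unit_gain_mono[OF _ restr_le]\<close>)
        moreover have "- {y} \<inter> - set cs = - set cs - {y}" by blast
        ultimately show ?thesis by (simp add: H2_def restr_restr)
      qed
      have "\<not> on_cycle H1 y" using D(2) on_cycle_mono[OF restr_le, of adj "- set cs" y] by (auto simp: H1_def)
      then have "is_cycle H2 = is_cycle H1" unfolding H2 by (intro is_cycle_restr_off) auto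
      then have cyc_H2: "cyc_edge H2 = cyc_edge H1" "noncyc H2 = noncyc H1"
        by (auto simp: cyc_edge_def on_cycle_def noncyc_def fun_eq_iff)
      have noncyc_H1: "noncyc H1 = noncyc adj \<union> set cs"
      proof -
        have "on_cycle H1 v \<longleftrightarrow> on_cycle adj v \<and> v \<notin> set cs" for v
        proof
          assume "on_cycle H1 v"
          then show "on_cycle adj v \<and> v \<notin> set cs" by (auto simp: H1_def on_cycle_def is_cycle_restr_iff)
        next
          assume v: "on_cycle adj v \<and> v \<notin> set cs"
          then obtain c where c: "is_cycle adj c" "v \<in> set c" by (auto simp: on_cycle_def)
          then have "set c \<inter> set cs = {}" using cycles_disjoint_edge(2)[OF d c(1) cs(1)] v by blast
          then show "on_cycle H1 v" using c by (auto simp: H1_def on_cycle_def is_cycle_restr_iff)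
        qed
        then show ?thesis by (auto simp: noncyc_def)
      qed
      have dis: "noncyc adj \<inter> set cs = {}" using cs(1) by (auto simp: noncyc_def on_cycle_def)
      \<comment> \<open>The vertices of \<open>cs\<close> become non-cyclic in \<open>H1\<close> but
        are isolated there, so the forest is the same.\<close>
      have F1: "restr H1 (noncyc H1) = restr adj (noncyc adj)"
        unfolding noncyc_H1 using dis by (auto simp: H1_def restr_def fun_eq_iff)
      have O12: "cyc_graph H2 = cyc_graph H1"
      proof (intro ext iffI)
        fix a b assume "cyc_graph H1 a b"
        moreover from this have "a \<noteq> y" "b \<noteq> y"
          using cyc_edge_on_cycle[of H1 a b] \<open>\<not> on_cycle H1 y\<close> simple_graph_restr[OF g]
          by (auto simp: cyc_graph_def H1_def)
        ultimately show "cyc_graph H2 a b" by (auto simp: cyc_graph_def H2 restr_def cyc_H2[unfolded H2])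
      qed (auto simp: cyc_graph_def H2 restr_def cyc_H2[unfolded H2])
      obtain K1 where K1: "card K1 \<le> tau (restr adj (noncyc adj))"
        "\<And>u v. H1 u v \<Longrightarrow> \<not> cyc_edge H1 u v \<Longrightarrow> u \<in> K1 \<or> v \<in> K1"
        using IH[of "- set cs" x y] opt1 xy(1) x F1 unfolding forest_cover_def H1_def[symmetric] by auto
      obtain K2 where K2: "K2 \<subseteq> noncyc H2" "card K2 \<le> tau (restr H2 (noncyc H2))"
        "\<And>u v. H2 u v \<Longrightarrow> \<not> cyc_edge H2 u v \<Longrightarrow> u \<in> K2 \<or> v \<in> K2"
        using IH[of "- set cs - {y}" x y] opt2 xy(1) x unfolding forest_cover_def H2_def[symmetric] by auto
      \<comment> \<open>With t the cover number of the common cycle part and F the forest: card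
        \<open>K2\<close> + t \<le> \<tau>(\<open>H2\<close>) \<le> \<tau>(\<open>H1\<close>) - 1
        \<le> \<tau>(F) + t - 1. This leaves room in the cover for \<open>y\<close>.\<close>
      have "tau H1 \<le> tau (restr adj (noncyc adj)) + tau (cyc_graph H1)"
        using tau_le_forest_cover[of H1 K1] K1 by fastforce
      moreover have "card K2 + tau (cyc_graph H1) \<le> tau H2"
        using tau_forest_cyc_graph[of H2] K2(2) g simple_graph_restr by (fastforce simp: H2_def O12[symmetric])
      \<comment> \<open>A cover of the cycle through \<open>x\<close> also covers \<open>xy\<close>,
        so \<tau> \<le> ceil(l/2) + \<tau>(\<open>H1\<close>). Deleting \<open>y\<close> lowers
        \<tau> by one and leaves at least ceil(l/2) + \<tau>(\<open>H2\<close>).\<close>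
      moreover have "tau H2 + 1 \<le> tau H1"
      proof -
        obtain S where S: "x \<in> S" "card S \<le> (length cs + 1) div 2" "cover (restr adj (set cs)) S"
          using cycle_cover[OF cs(1) x cycle_inner[OF g d cs(1)]] .
        obtain T where T: "cover H1 T" "card T = tau H1" using tau_obtain .
        have "cover adj (S \<union> T)"
          unfolding cover_def
        proof (intro allI impI)
          fix a b assume ab: "adj a b"
          show "a \<in> S \<union> T \<or> b \<in> S \<union> T"
            using S T(1) leave[OF ab] leave'[OF ab] ab
            by (cases "a \<in> set cs"; cases "b \<in> set cs") (auto simp: cover_def H1_def restr_def)
        qed
        then have "tau adj \<le> card (S \<union> T)" by (rule tau_le)
        then have "tau adj \<le> (length cs + 1) div 2 + tau H1" using card_Un_le[of S T] S(2) T(2) by simp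
        moreover have "tau (restr adj (set cs)) + tau H2 \<le> tau (restr adj (- {y}))"
          using y by (intro tau_superadd[where W = "set cs"]) (auto simp: restr_def H2_def)
        ultimately show ?thesis using tau_cycle_ge[OF cs(1)] D(3) by linarith
      qed
      ultimately have card_K2: "card K2 + 1 \<le> tau (restr adj (noncyc adj))" by linarith
      show ?thesis
        unfolding forest_cover_def
      \<comment> \<open>\<open>K2\<close> may contain vertices of \<open>cs\<close>, which are
        non-cyclic only in \<open>H2\<close>. They cover nothing there and are discarded.\<close>
      proof (intro exI[of _ "insert y (K2 - set cs)"] conjI allI impI)
        show "insert y (K2 - set cs) \<subseteq> noncyc adj"
          using K2(1) D(2) by (auto simp: cyc_H2 noncyc_H1) (simp add: noncyc_def)
        have "card (insert y (K2 - set cs)) \<le> card (insert y K2)" by (rule card_mono) auto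
        also have "\<dots> \<le> Suc (card K2)" by (simp add: card_insert_if)
        finally show "card (insert y (K2 - set cs)) \<le> tau (restr adj (noncyc adj))" using card_K2 by simp
        fix a b assume ab: "adj a b" "\<not> cyc_edge adj a b"
        show "a \<in> insert y (K2 - set cs) \<or> b \<in> insert y (K2 - set cs)"
        proof (cases "a = y \<or> b = y")
          case False
          have "\<not> (a \<in> set cs \<and> b \<in> set cs)" using ab chord_cyc_edge[OF g cs(1)] by blast
          then have "a \<notin> set cs" "b \<notin> set cs" using leave[OF ab(1)] leave'[OF ab(1)] False by auto
          then have "H2 a b" using False ab(1) by (simp add: H2_def restr_def)
          moreover have "\<not> cyc_edge H2 a b" using ab(2) cyc_edge_mono[OF restr_le, of adj "- set cs - {y}" a b] by (auto simp: H2_def)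
          ultimately show ?thesis using K2(3) \<open>a \<notin> set cs\<close> \<open>b \<notin> set cs\<close> by blast
        qed auto
      qed
    qed
  qed
qed

section \<open>Sufficiency of the three conditions\<close>

lemma cyclomatic_remove_cycle:
  fixes adj :: "'n::finite \<Rightarrow> 'n \<Rightarrow> bool"
  assumes g: "simple_graph adj" and d: "cycles_disjoint adj" and cs: "is_cycle adj cs"
  shows "cyclomatic (restr adj (- set cs)) = cyclomatic adj - 1"
proof -
  obtain b where e: "{cs ! 0, b} \<in> cycle_edges cs" using cycle_edge_at[OF cycle_hd_in[OF cs]] by blast
  let ?a = "cs ! 0"
  let ?D = "del adj ?a b"
  have ab: "adj ?a b" "cyc_edge adj ?a b" "?a \<in> set cs"
    using cycle_edges_D[OF cs g e] e cs by (auto simp: cyc_edge_def)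
  \<comment> \<open>With one edge of \<open>cs\<close> gone, the other edges meeting
    \<open>cs\<close> are bridges: a cycle through one would share a vertex with \<open>cs\<close>,
    hence be the broken cycle.\<close>
  have "cyclomatic (restr adj (- set cs)) = cyclomatic ?D"
  proof (rule cyclomatic_remove_noncyclic)
    show "restr adj (- set cs) \<le> ?D"
      using g ab(3) by (intro le_del restr_le simple_graph_restr) (auto simp: restr_def)
    fix u v assume uv: "?D u v" "\<not> restr adj (- set cs) u v"
    show "\<not> cyc_edge ?D u v"
    proof
      assume "cyc_edge ?D u v"
      then obtain c where c: "is_cycle ?D c" "{u, v} \<in> cycle_edges c" by (auto simp: cyc_edge_def)
      have uvc: "u \<in> set c" "v \<in> set c" using cycle_edges_D[OF c(1) simple_graph_del[OF g] c(2)] by auto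
      have "u \<in> set cs \<or> v \<in> set cs" using uv by (auto simp: restr_def del_def)
      then have "cycle_edges c = cycle_edges cs"
        using cycles_disjoint_edge(1)[OF d is_cycle_mono[OF del_le c(1)] cs] uvc by blast
      then have "?D ?a b" using cycle_edges_D(1)[OF c(1) simple_graph_del[OF g]] e by blast
      then show False by (simp add: del_def)
    qed
  qed (use g in \<open>simp_all add: simple_graph_restr simple_graph_del\<close>)
  then show ?thesis using cyclomatic_del[OF g ab(1)] ab(2) by simp
qed

lemma cycles_disjoint_mono: "h \<le> g \<Longrightarrow> cycles_disjoint g \<Longrightarrow> cycles_disjoint h"
  unfolding cycles_disjoint_def using is_cycle_mono by metis

lemma gain_condition_mono: "h \<le> g \<Longrightarrow> gain_condition g \<phi> \<Longrightarrow> gain_condition h \<phi>"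
  unfolding gain_condition_def using is_cycle_mono by metis

text \<open>Vertex sets instead of lists, since rotations and reversals of a list describe one
  cycle. They are also the labels of the cyclic vertices in \<open>contr\<close>.\<close>

definition cycle_sets :: "('n \<Rightarrow> 'n \<Rightarrow> bool) \<Rightarrow> 'n set set" where
  "cycle_sets adj = {set cs | cs. is_cycle adj cs}"

lemma card_cycle_sets:
  fixes adj :: "'n::finite \<Rightarrow> 'n \<Rightarrow> bool"
  assumes "simple_graph adj" "cycles_disjoint adj"
  shows "int (card (cycle_sets adj)) = cyclomatic adj"
  using assms
proof (induction "card (edges adj)" arbitrary: adj rule: less_induct)
  case less
  note g = less.prems(1) and d = less.prems(2)
  show ?case
  proof (cases "\<exists>cs. is_cycle adj cs")
    case False
    have "cyclomatic (\<lambda>_ _ :: 'n. False) = cyclomatic adj"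
      using g False by (intro cyclomatic_remove_noncyclic) (auto simp: simple_graph_def cyc_edge_def)
    moreover have "cycle_sets adj = {}" using False by (simp add: cycle_sets_def)
    ultimately show ?thesis using cyclomatic_empty[of "\<lambda>_ _ :: 'n. False"] by simp
  next
    case True
    then obtain cs where cs: "is_cycle adj cs" by blast
    let ?H = "restr adj (- set cs)"
    have "on_cycle adj (cs ! 0)" using cs cycle_hd_in by (auto simp: on_cycle_def)
    then obtain b where b: "adj (cs ! 0) b" using on_cycle_edge[OF g] by blast
    have "int (card (cycle_sets ?H)) = cyclomatic ?H"
      using cycle_hd_in[OF cs] g d b
      by (intro less.hyps card_edges_restr_less[of _ "cs ! 0" b] simple_graph_restr cycles_disjoint_mono[OF restr_le]) auto
    moreover have "cycle_sets adj = insert (set cs) (cycle_sets ?H)"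
    proof -
      have "set c = set cs \<or> set c \<subseteq> - set cs" if "is_cycle adj c" for c
        using cycles_disjoint_edge(2)[OF d that cs] by blast
      then show ?thesis using cs unfolding cycle_sets_def is_cycle_restr_iff by blast
    qed
    moreover have "set cs \<notin> cycle_sets ?H"
    proof
      assume "set cs \<in> cycle_sets ?H"
      then obtain c where "set cs = set c" "set c \<subseteq> - set cs" by (auto simp: cycle_sets_def is_cycle_restr_iff)
      then show False using cycle_hd_in[OF cs] by blast
    qed
    ultimately show ?thesis using cyclomatic_remove_cycle[OF g d cs] by simp
  qed
qed

lemma rank_singular_cycles_le:
  fixes adj :: "'n::finite \<Rightarrow> 'n \<Rightarrow> bool"
  assumes "simple_graph adj" "unit_gain adj \<phi>" "cycles_disjoint adj" "gain_condition adj \<phi>"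
    and "\<And>u v. adj u v \<Longrightarrow> cyc_edge adj u v"
  shows "int (rank (M adj \<phi>)) \<le> 2 * int (tau adj) - 2 * cyclomatic adj"
  using assms
proof (induction "card (edges adj)" arbitrary: adj rule: less_induct)
  case less
  note g = less.prems(1) and u = less.prems(2) and d = less.prems(3) and gc = less.prems(4) and e = less.prems(5)
  show ?case
  proof (cases "\<exists>u v. adj u v")
    case False
    then show ?thesis using gain_matrix_empty[of adj \<phi>] cyclomatic_empty[of adj] by simp
  next
    case True
    then obtain cs where cs: "is_cycle adj cs" using e by (auto simp: cyc_edge_def)
    let ?x = "cs ! 0" and ?C = "restr adj (set cs)" and ?H = "restr adj (- set cs)"
    have x: "?x \<in> set cs" by (rule cycle_hd_in[OF cs])
    then have "on_cycle adj ?x" using cs by (auto simp: on_cycle_def)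
    then obtain b where b: "adj ?x b" using on_cycle_edge[OF g] by blast
    have sep: "v \<in> set cs \<longleftrightarrow> u \<in> set cs" if uv: "adj u v" for u v
    proof -
      obtain c where c: "is_cycle adj c" "{u, v} \<in> cycle_edges c" using e[OF uv] by (auto simp: cyc_edge_def)
      have "u \<in> set c" "v \<in> set c" using cycle_edges_D[OF c(1) g c(2)] by auto
      then show ?thesis using cycles_disjoint_edge(2)[OF d c(1) cs] by blast
    qed
    have "int (rank (M ?H \<phi>)) \<le> 2 * int (tau ?H) - 2 * cyclomatic ?H"
    proof (rule less.hyps)
      show "card (edges ?H) < card (edges adj)" using card_edges_restr_less[OF g b, of "- set cs"] x by auto
      fix u v assume uv: "?H u v"
      then obtain c where c: "is_cycle adj c" "{u, v} \<in> cycle_edges c" using e by (auto simp: cyc_edge_def restr_def)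
      have "u \<in> set c" using cycle_edges_D[OF c(1) g c(2)] by auto
      then have "set c \<subseteq> - set cs" using cycles_disjoint_edge(2)[OF d c(1) cs] uv by (auto simp: restr_def)
      then show "cyc_edge ?H u v" using c by (auto simp: cyc_edge_def is_cycle_restr_iff)
    qed (use g u d gc in \<open>auto intro: simple_graph_restr unit_gain_mono[OF _ restr_le]
        cycles_disjoint_mono[OF restr_le] gain_condition_mono[OF restr_le]\<close>)
    moreover have "rank (M adj \<phi>) \<le> rank (M ?C \<phi>) + rank (M ?H \<phi>)"
      using sep by (intro rank_split_le[OF g]) blast
    \<comment> \<open>Singularity allows deleting \<open>?x\<close> without loss of rank, and the
      remaining path is covered by one vertex fewer than the cycle.\<close>
    moreover have "rank (M ?C \<phi>) + 2 \<le> 2 * tau ?C"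
    proof -
      obtain w where "M ?C \<phi> *v w = 0" "w $ ?x \<noteq> 0"
        using singular_cycle_null_vector[OF g u d gc cs] x by blast
      then have "rank (M (restr ?C (- {?x})) \<phi>) = rank (M ?C \<phi>)"
        by (rule rank_gain_delete_eq[OF simple_graph_restr[OF g] unit_gain_mono[OF u restr_le]])
      moreover obtain S where S: "?x \<in> S" "card S \<le> (length cs + 1) div 2" "cover ?C S"
        using cycle_cover[OF cs x cycle_inner[OF g d cs]] .
      have "cover (restr ?C (- {?x})) (S - {?x})" using S(3) by (auto simp: cover_def restr_def)
      then have "rank (M (restr ?C (- {?x})) \<phi>) \<le> 2 * card (S - {?x})" by (rule rank_le_cover)
      moreover have "card S = Suc (card (S - {?x}))" using S(1) by (metis card_Suc_Diff1 finite)
      ultimately show ?thesis using S(2) tau_cycle_ge[OF cs] by linarith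
    qed
    moreover have "tau ?C + tau ?H \<le> tau adj"
      by (intro tau_superadd[where W = "set cs"] restr_le) (auto simp: restr_def)
    ultimately show ?thesis using cyclomatic_remove_cycle[OF g d cs] by linarith
  qed
qed

text \<open>Deleting \<open>K\<close> costs at most 2 card \<open>K\<close> in rank and leaves the
  cycles; then 2 card \<open>K\<close> + 2 \<tau>(\<open>?O\<close>) - 2c \<le> 2 \<tau> - 2c,
  because card \<open>K\<close> is bounded by the cover number of the forest.\<close>

lemma forest_cover_optimal:
  fixes adj :: "'n::finite \<Rightarrow> 'n \<Rightarrow> bool"
  assumes g: "simple_graph adj" and u: "unit_gain adj \<phi>" and d: "cycles_disjoint adj"
    and gc: "gain_condition adj \<phi>" and fc: "forest_cover adj"
  shows "optimal adj \<phi>"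
proof -
  obtain K where K: "K \<subseteq> noncyc adj" "card K \<le> tau (restr adj (noncyc adj))"
    "\<And>u v. adj u v \<Longrightarrow> \<not> cyc_edge adj u v \<Longrightarrow> u \<in> K \<or> v \<in> K"
    using fc unfolding forest_cover_def by blast
  let ?O = "restr adj (- K)"
  have same: "is_cycle ?O = is_cycle adj"
    using K(1) by (intro is_cycle_restr_off) (auto simp: noncyc_def)
  have O: "?O = cyc_graph adj"
  proof (intro ext iffI)
    fix a b assume "cyc_graph adj a b"
    then show "?O a b" using cyc_edge_on_cycle[OF g, of a b] K(1) by (auto simp: cyc_graph_def restr_def noncyc_def)
  qed (use K(3) in \<open>auto simp: restr_def cyc_graph_def\<close>)
  have "cyclomatic ?O = cyclomatic adj"
    using g by (intro cyclomatic_remove_noncyclic restr_le simple_graph_restr) (simp_all add: O cyc_graph_def)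
  moreover have "int (rank (M ?O \<phi>)) \<le> 2 * int (tau ?O) - 2 * cyclomatic ?O"
  proof (rule rank_singular_cycles_le)
    fix a b assume "?O a b"
    then have "cyc_edge adj a b" by (simp add: O cyc_graph_def)
    then show "cyc_edge ?O a b" by (simp add: cyc_edge_def same)
  qed (use g u d gc in \<open>auto intro: simple_graph_restr unit_gain_mono[OF _ restr_le]
        cycles_disjoint_mono[OF restr_le] gain_condition_mono[OF restr_le]\<close>)
  moreover have "rank (M adj \<phi>) \<le> rank (M ?O \<phi>) + 2 * card K" by (rule rank_restr_ge)
  moreover have "card K + tau ?O \<le> tau adj" using tau_forest_cyc_graph[OF g] K(2) by (simp add: O)
  ultimately show ?thesis using rank_lower_bound[OF g u] unfolding optimal_def by linarith
qed

lemma optimal_iff: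
  fixes adj :: "'n::finite \<Rightarrow> 'n \<Rightarrow> bool"
  assumes "simple_graph adj" "unit_gain adj \<phi>"
  shows "optimal adj \<phi> \<longleftrightarrow> cycles_disjoint adj \<and> gain_condition adj \<phi> \<and> forest_cover adj"
  using forest_cover_optimal[OF assms] optimal_cycles_disjoint[OF assms] optimal_gain_condition[OF assms]
    optimal_forest_cover[OF assms] by blast

subsection \<open>The contracted graph\<close>

context
  fixes adj :: "'n::finite \<Rightarrow> 'n \<Rightarrow> bool"
  assumes g: "simple_graph adj" and d: "cycles_disjoint adj"
begin

lemma contr_noncyc: "v \<in> noncyc adj \<Longrightarrow> contr adj v = Inl v"
  by (auto simp: contr_def noncyc_def on_cycle_def)

text \<open>Disjointness makes the choice of a cycle through \<open>v\<close> irrelevant: all of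
  them have the same vertex set.\<close>

lemma contr_cycle:
  assumes "is_cycle adj cs" "v \<in> set cs"
  shows "contr adj v = Inr (set cs)"
proof -
  have "\<exists>c. is_cycle adj c \<and> v \<in> set c" using assms by blast
  moreover from someI_ex[OF this]
  have "set (SOME c. is_cycle adj c \<and> v \<in> set c) = set cs"
    using cycles_disjoint_edge(2)[OF d _ assms(1)] assms(2) by blast
  ultimately show ?thesis by (simp add: contr_def)
qed

lemma contr_eq_Inl: "contr adj v = Inl u \<longleftrightarrow> v = u \<and> u \<in> noncyc adj"
  by (auto simp: contr_def noncyc_def on_cycle_def)

lemma TG_noncyclic_eq: "TG_noncyclic_vertices adj = Inl ` noncyc adj"
proof -
  have "isl (contr adj v) \<longleftrightarrow> v \<in> noncyc adj" for v
    by (auto simp: contr_def noncyc_def on_cycle_def)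
  then show ?thesis
    unfolding TG_noncyclic_vertices_def TG_vertices_def using contr_noncyc by (auto simp: image_iff) metis
qed

lemma TG_vertices_eq: "TG_vertices adj = Inl ` noncyc adj \<union> Inr ` cycle_sets adj"
proof
  show "TG_vertices adj \<subseteq> Inl ` noncyc adj \<union> Inr ` cycle_sets adj"
  proof
    fix z assume "z \<in> TG_vertices adj"
    then obtain v where v: "z = contr adj v" by (auto simp: TG_vertices_def)
    show "z \<in> Inl ` noncyc adj \<union> Inr ` cycle_sets adj"
    proof (cases "v \<in> noncyc adj")
      case True then show ?thesis using v contr_noncyc by auto
    next
      case False
      then obtain cs where "is_cycle adj cs" "v \<in> set cs" by (auto simp: noncyc_def on_cycle_def)
      then show ?thesis using v contr_cycle by (auto simp: cycle_sets_def)
    qed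
  qed
  have "Inl v \<in> TG_vertices adj" if "v \<in> noncyc adj" for v
    using contr_noncyc[OF that] by (metis TG_vertices_def rangeI)
  moreover have "Inr (set cs) \<in> TG_vertices adj" if "is_cycle adj cs" for cs
    using contr_cycle[OF that cycle_hd_in[OF that]] by (metis TG_vertices_def rangeI)
  ultimately show "Inl ` noncyc adj \<union> Inr ` cycle_sets adj \<subseteq> TG_vertices adj"
    by (auto simp: cycle_sets_def)
qed

lemma TG_adj_Inl: "TG_adj adj (Inl u) (Inl v) \<longleftrightarrow> adj u v \<and> u \<in> noncyc adj \<and> v \<in> noncyc adj"
  using simple_graph_irrefl[OF g] by (auto simp: TG_adj_def contr_eq_Inl)

lemma indep_num_noncyclic:
  "indep_num (TG_noncyclic_vertices adj) (TG_adj adj) + tau (restr adj (noncyc adj)) = card (noncyc adj)"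
proof -
  let ?N = "noncyc adj"
  obtain S where S: "cover (restr adj ?N) S" "card S = tau (restr adj ?N)" using tau_obtain .
  have "card (Inl ` (?N - S) :: ('n + 'n set) set) \<le> indep_num (TG_noncyclic_vertices adj) (TG_adj adj)"
  proof (rule indep_num_card_le)
    have "\<not> adj u v" if "u \<in> ?N - S" "v \<in> ?N - S" for u v
      using S(1) that unfolding cover_def restr_def by blast
    then show "\<not> TG_adj adj x y" if "x \<in> Inl ` (?N - S)" "y \<in> Inl ` (?N - S)" for x y
      using that by (auto simp: TG_adj_Inl)
  qed (auto simp: TG_noncyclic_eq)
  then have "card (?N - S) \<le> indep_num (TG_noncyclic_vertices adj) (TG_adj adj)"
    by (simp add: card_image)
  moreover have "card ?N - card S \<le> card (?N - S)" by (rule diff_card_le_card_Diff) simp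
  moreover obtain I where I: "I \<subseteq> Inl ` ?N" "\<And>x y. x \<in> I \<Longrightarrow> y \<in> I \<Longrightarrow> \<not> TG_adj adj x y"
    "card I = indep_num (TG_noncyclic_vertices adj) (TG_adj adj)"
    using indep_num_obtain[of "TG_noncyclic_vertices adj" "TG_adj adj"] unfolding TG_noncyclic_eq by auto
  then obtain J where J: "J \<subseteq> ?N" "I = Inl ` J" by (auto simp: subset_image_iff)
  have "cover (restr adj ?N) (?N - J)"
  proof -
    have "\<not> adj u v" if "u \<in> J" "v \<in> J" for u v
      using I(2)[of "Inl u" "Inl v"] that J by (auto simp: TG_adj_Inl)
    then show ?thesis unfolding cover_def restr_def by blast
  qed
  then have "tau (restr adj ?N) \<le> card (?N - J)" by (rule tau_le)
  then have "tau (restr adj ?N) \<le> card ?N - card J" using J(1) by (simp add: card_Diff_subset)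
  moreover have "card I = card J" unfolding J(2) by (simp add: card_image)
  moreover have "card J \<le> card ?N" using J(1) by (simp add: card_mono)
  ultimately show ?thesis using I(3) S(2) by linarith
qed

text \<open>Together with the converse below: the edges that vanish under contraction are exactly
  those on cycles, so the edges of T_G come from those that \<open>forest_cover\<close> speaks
  of.\<close>

lemma contr_eq_imp_cyc_edge:
  assumes "adj a b" "contr adj a = contr adj b"
  shows "cyc_edge adj a b"
proof (cases "a \<in> noncyc adj")
  case True
  then show ?thesis using assms contr_noncyc simple_graph_irrefl[OF g] by (metis contr_eq_Inl)
next
  case False
  then obtain cs where cs: "is_cycle adj cs" "a \<in> set cs" by (auto simp: noncyc_def on_cycle_def)
  have "b \<notin> noncyc adj" using assms(2) contr_cycle[OF cs] contr_noncyc[of b] by auto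
  then obtain c where c: "is_cycle adj c" "b \<in> set c" by (auto simp: noncyc_def on_cycle_def)
  have "set c = set cs" using assms(2) contr_cycle[OF cs] contr_cycle[OF c] by simp
  then show ?thesis using chord_cyc_edge[OF g cs _ assms(1)] c(2) by simp
qed

lemma cyc_edge_imp_contr_eq: "cyc_edge adj a b \<Longrightarrow> contr adj a = contr adj b"
  unfolding cyc_edge_def using contr_cycle cycle_edges_D(2,3)[OF _ g] by metis

text \<open>Splitting an independent set into non-cyclic and cyclic vertices gives \<alpha>(T_G)
  \<le> \<alpha>([T_G]) + c, so (iii) is an extremal case.\<close>

lemma indep_num_TG_le:
  assumes "I \<subseteq> TG_vertices adj" "\<And>x y. x \<in> I \<Longrightarrow> y \<in> I \<Longrightarrow> \<not> TG_adj adj x y"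
  shows "card (I \<inter> range Inl) \<le> indep_num (TG_noncyclic_vertices adj) (TG_adj adj)"
    and "card (I \<inter> range Inr) \<le> card (cycle_sets adj)"
    and "card I = card (I \<inter> range Inl) + card (I \<inter> range Inr)"
proof -
  show "card (I \<inter> range Inl) \<le> indep_num (TG_noncyclic_vertices adj) (TG_adj adj)"
    using assms unfolding TG_vertices_eq TG_noncyclic_eq by (intro indep_num_card_le) auto
  have "card (I \<inter> range Inr) \<le> card (Inr ` cycle_sets adj :: ('n + 'n set) set)"
    using assms(1) unfolding TG_vertices_eq by (intro card_mono) auto
  then show "card (I \<inter> range Inr) \<le> card (cycle_sets adj)" by (simp add: card_image)
  have "I = (I \<inter> range Inl) \<union> (I \<inter> range Inr)" by (auto intro: sum.exhaust_sel)
  moreover have "card ((I \<inter> range Inl) \<union> (I \<inter> range Inr)) = card (I \<inter> range Inl) + card (I \<inter> range Inr)"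
    by (rule card_Un_disjoint) auto
  ultimately show "card I = card (I \<inter> range Inl) + card (I \<inter> range Inr)" by simp
qed

lemma indep_num_TG_iff_forest_cover:
  "int (indep_num (TG_vertices adj) (TG_adj adj)) =
     int (indep_num (TG_noncyclic_vertices adj) (TG_adj adj)) + cyclomatic adj \<longleftrightarrow> forest_cover adj"
proof -
  let ?N = "noncyc adj" and ?T = "TG_adj adj" and ?a = "indep_num (TG_noncyclic_vertices adj) (TG_adj adj)"
  have "indep_num (TG_vertices adj) ?T = ?a + card (cycle_sets adj) \<longleftrightarrow> forest_cover adj"
  proof
    assume eq: "indep_num (TG_vertices adj) ?T = ?a + card (cycle_sets adj)"
    obtain I where I: "I \<subseteq> TG_vertices adj" "\<And>x y. x \<in> I \<Longrightarrow> y \<in> I \<Longrightarrow> \<not> ?T x y"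
      "card I = indep_num (TG_vertices adj) ?T" using indep_num_obtain[of "TG_vertices adj" ?T] by auto
    note le = indep_num_TG_le[OF I(1,2)]
    \<comment> \<open>Both bounds are attained: \<open>I\<close> contains all cyclic vertices, and
      its other members form a maximum independent set of the forest, whose complement is the
      cover.\<close>
    have cards: "card (I \<inter> range Inl) = ?a" "card (I \<inter> range Inr) = card (cycle_sets adj)"
      using le eq I(3) by linarith+
    have "I \<inter> range Inr = Inr ` cycle_sets adj"
      using cards(2) I(1) unfolding TG_vertices_eq by (intro card_subset_eq) (auto simp: card_image)
    then have cyc_in: "Inr X \<in> I" if "X \<in> cycle_sets adj" for X using that by blast
    define J where "J = {v \<in> ?N. Inl v \<in> I}"
    have "I \<inter> range Inl = Inl ` J" using I(1) unfolding TG_vertices_eq by (auto simp: J_def)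
    then have cJ: "card J = ?a" using cards(1) by (simp add: card_image)
    have J: "J \<subseteq> ?N" by (auto simp: J_def)
    show "forest_cover adj"
      unfolding forest_cover_def
    proof (intro exI[of _ "?N - J"] conjI allI impI)
      show "card (?N - J) \<le> tau (restr adj ?N)"
        using indep_num_noncyclic cJ J by (simp add: card_Diff_subset)
      fix u v assume uv: "adj u v" "\<not> cyc_edge adj u v"
      show "u \<in> ?N - J \<or> v \<in> ?N - J"
      proof (rule ccontr)
        assume neg: "\<not> ?thesis"
        have "contr adj w \<in> I" if "w \<notin> ?N - J" for w
        proof (cases "w \<in> ?N")
          case True then show ?thesis using that contr_noncyc by (auto simp: J_def)
        next
          case False
          then obtain cs where "is_cycle adj cs" "w \<in> set cs" by (auto simp: noncyc_def on_cycle_def)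
          then show ?thesis using cyc_in contr_cycle by (auto simp: cycle_sets_def)
        qed
        then have "contr adj u \<in> I" "contr adj v \<in> I" using neg by auto
        moreover have "?T (contr adj u) (contr adj v)"
          using uv contr_eq_imp_cyc_edge by (auto simp: TG_adj_def)
        ultimately show False using I(2) by blast
      qed
    qed auto
  next
    assume "forest_cover adj"
    then obtain K where K: "K \<subseteq> ?N" "card K \<le> tau (restr adj ?N)"
      "\<And>u v. adj u v \<Longrightarrow> \<not> cyc_edge adj u v \<Longrightarrow> u \<in> K \<or> v \<in> K"
      unfolding forest_cover_def by blast
    let ?S = "Inl ` (?N - K) \<union> Inr ` cycle_sets adj"
    have no: "contr adj v \<notin> ?S" if "v \<in> K" for v using that K(1) contr_noncyc by auto
    have "card ?S \<le> indep_num (TG_vertices adj) ?T"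
    proof (rule indep_num_card_le)
      fix x y assume xy: "x \<in> ?S" "y \<in> ?S"
      show "\<not> ?T x y"
      proof
        assume "?T x y"
        then obtain u v where uv: "x \<noteq> y" "adj u v" "contr adj u = x" "contr adj v = y"
          by (auto simp: TG_adj_def)
        then have "u \<in> K \<or> v \<in> K" using K(3) cyc_edge_imp_contr_eq by blast
        then show False using no uv xy by blast
      qed
    qed (auto simp: TG_vertices_eq)
    moreover have "card ?S = card (Inl ` (?N - K) :: ('n + 'n set) set) + card (Inr ` cycle_sets adj :: ('n + 'n set) set)"
      by (rule card_Un_disjoint) auto
    then have "card ?S = card ?N - card K + card (cycle_sets adj)"
      using K(1) by (simp add: card_image card_Diff_subset)
    moreover obtain I where I: "I \<subseteq> TG_vertices adj" "\<And>x y. x \<in> I \<Longrightarrow> y \<in> I \<Longrightarrow> \<not> ?T x y"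
      "card I = indep_num (TG_vertices adj) ?T" using indep_num_obtain[of "TG_vertices adj" ?T] by auto
    ultimately show "indep_num (TG_vertices adj) ?T = ?a + card (cycle_sets adj)"
      using indep_num_TG_le[OF I(1,2)] indep_num_noncyclic K(2) by linarith
  qed
  then show ?thesis by (metis card_cycle_sets[OF g d] of_nat_add of_nat_eq_iff)
qed

end

theorem theorem1p2:
  fixes adj :: "'n::finite \<Rightarrow> 'n \<Rightarrow> bool" and \<phi> :: "'n \<Rightarrow> 'n \<Rightarrow> complex"
  assumes "simple_graph adj" and "unit_gain adj \<phi>"
  shows "int (rank (gain_adj_matrix adj \<phi>)) =
           2 * int CARD('n) - 2 * cyclomatic adj - 2 * int (indep_num UNIV adj)
         \<longleftrightarrow> cycles_disjoint adj \<and> gain_condition adj \<phi> \<and>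
             int (indep_num (TG_vertices adj) (TG_adj adj)) =
               int (indep_num (TG_noncyclic_vertices adj) (TG_adj adj)) + cyclomatic adj"
proof -
  have "int (indep_num UNIV adj) + int (tau adj) = int CARD('n)"
    using indep_num_UNIV[of adj] by (simp flip: of_nat_add)
  then have "int (rank (gain_adj_matrix adj \<phi>)) =
      2 * int CARD('n) - 2 * cyclomatic adj - 2 * int (indep_num UNIV adj) \<longleftrightarrow> optimal adj \<phi>"
    unfolding optimal_def by linarith
  then show ?thesis
    using optimal_iff[OF assms] indep_num_TG_iff_forest_cover[OF assms(1)] by blast
qed

end
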